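(* Let $p\in\{0,1\}$ and let $R$ and $V$ be $m\times m$ matrix functions on $D$ of the form $$R(x,t)=\mathrm{diag}\{\rho_1(x,t),\rho_2(x,t)\}=-R(-x,t)^*,\qquad V(x,t)=\begin{bmatrix}0&v(x,t)\\ v(-x,t)^*&0\end{bmatrix}.$$ Let $V_t$ be continuous in $D$ and let $R$ and $V$ satisfy in $D$ $$R_x=\frac{(-1)^p}2(VV_t+V_tV),\qquad V_{tx}=\frac12(VR+RV).$$ Let $n\in\mathbb N$, let $A$ and $S(0,0)=-S(0,0)^*$ be invertible complex $n\times n$ matrices and let $\Pi(0,0)$ be a complex $n\times m$ matrix such that $$AS(0,0)+S(0,0)A^*=\mathrm i\,\Pi(0,0)j^p\Pi(0,0)^*.$$ Then $\Pi(x,t)$, $S(x,t)$ (solutions, with the given values at $(0,0)$, of the linear systems of the context) and, for $\lambda\neq0$, a wave function $w(x,t,\lambda)$ (an $m\times m$ solution of $w_x=Gw$, $w_t=Fw$ with $\det w(0,0,\lambda)\ne0$) are well defined in $D$. Moreover, at the points of $D$ where $S(x,t)$ is invertible, the matrix functions $$\widetilde R=\frac1{2\mathrm i}\big(\widetilde Q_{-1}j+j\widetilde Q_{-1}\big),$$ $$\widetilde V(x,t)=V(x,t)+\frac{\mathrm i}2\Big(\Pi(-x,t)^*S(x,t)^{-1}\Pi(x,t)-j\,\Pi(-x,t)^*S(x,t)^{-1}\Pi(x,t)\,j\Big)$$ satisfy the nonlocal matrix dispersionless equations, that is, $$\widetilde R(x,t)=\mathrm{diag}\{\widetilde\rho_1(x,t),\widetilde\rho_2(x,t)\}=-\widetilde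 R(-x,t)^*,$$ $$\widetilde V(x,t)=\begin{bmatrix}0&\widetilde v(x,t)\\ \widetilde v(-x,t)^*&0\end{bmatrix}=\widetilde V(-x,t)^*,\qquad \widetilde v(x,t)=v(x,t)+\mathrm i\,\Phi_1(-x,t)^*S(x,t)^{-1}\Phi_2(x,t),$$ and $$\widetilde R_x=\frac{(-1)^p}2(\widetilde V\widetilde V_t+\widetilde V_t\widetilde V),\qquad \widetilde V_{tx}=\frac12(\widetilde V\widetilde R+\widetilde R\widetilde V).$$ The wave function $\widetilde w$ ($\det\widetilde w(0,0,\lambda)\ne0$) corresponding to the transformed equations is $\widetilde w=w_A\,w$, where $$w_A(x,t,\lambda)=I_m-\mathrm i j^p\Pi(-x,t)^*S(x,t)^{-1}(A-\lambda I_n)^{-1}\Pi(x,t);$$ that is, for $\lambda\notin\{0\}\cup\sigma(A)\cup\sigma(-A^* )$, $\widetilde w_x=\widetilde G\widetilde w$ and $\widetilde w_t=\widetilde F\widetilde w$ with $\widetilde G=\frac{\mathrm i}4\lambda j-\frac{\mathrm i}2j^{p+1}\widetilde V$ and $\widetilde F=\frac1\lambda(-\mathrm i j\widetilde R+j^p\widetilde V_t)$.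
   Context: Notation. $m_1,m_2\ge1$, $m=m_1+m_2$, $j=\begin{bmatrix}I_{m_1}&0\\0&-I_{m_2}\end{bmatrix}$; $\rho_k$ is an $m_k\times m_k$ complex matrix function and $v$ is an $m_1\times m_2$ one; subscripts $x,t$ denote partial derivatives (in particular $V_t$ denotes $\partial V/\partial t$); $^*$ is the conjugate transpose; $\sigma(\cdot)$ is the spectrum. The domain is $D=\{(x,t):\ -a<x<a,\ b_1<t<b_2\}$ with $0<a\le\infty$, $-\infty\le b_1<0<b_2\le\infty$ (so $(0,0)\in D$ and $D$ is symmetric under $x\mapsto-x$). Auxiliary systems: $G(x,t,\lambda)=\frac{\mathrm i}4\lambda j-\frac{\mathrm i}2j^{p+1}V(x,t)$, $F(x,t,\lambda)=\frac1\lambda(-\mathrm i jR(x,t)+j^pV_t(x,t))$. Coefficients: $q_1=-\frac{\mathrm i}4j$, $q_0=\frac{\mathrm i}2j^{p+1}V$, $Q_{-1}=\mathrm i jR-j^pV_t$. Linear systems: $\Pi_x=\Pi q_0+A\Pi q_1$, $\Pi_t=A^{-1}\Pi Q_{-1}$, and $$S_x(x,t)=\mathrm i\,\Pi(x,t)q_1j^p\Pi(-x,t)^*,\qquad S_t(x,t)=\mathrm i A^{-1}\Pi(x,t)Q_{-1}(x,t)j^p\Pi(-x,t)^*(A^* )^{-1}.$$ $\Pi=[\Phi_1\ \ \Phi_2]$ is the partition into $n\times m_1$ and $n\times m_2$ blocks. At points where $S$ is invertible, $$X_{-1}(x,t)=\mathrm i j^p\Pi(-x,t)^*S(x,t)^{-1}A^{-1}\Pi(x,t),\quad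 Y_{-1}(x,t)=-\mathrm i j^p\Pi(-x,t)^*(A^{-1})^*S(x,t)^{-1}\Pi(x,t),$$ $$\widetilde Q_{-1}=(I_m-X_{-1})Q_{-1}(I_m+Y_{-1}).$$ A wave function corresponding to a solution of the equations is an $m\times m$ matrix solution, with nonzero determinant at $(0,0)$, of the associated pair of auxiliary linear systems.
   Formalization: R and V themselves are also assumed continuous in D, not only V_t; otherwise R=0 with V=V(x) having a jump, or V=0 with R=R(t) having a jump, meets all hypotheses although the linear systems have no classical solution. *)

theory Defs
  imports "HOL-Analysis.Analysis"
begin

text \<open>
  Block sizes are index types: an \<open>m\<^sub>1 \<times> m\<^sub>2\<close> matrix has type \<open>complex ^ 'm2 ^ 'm1\<close>, and
  \<open>m = m\<^sub>1 + m\<^sub>2\<close> is the sum type \<open>'m1 + 'm2\<close>. Matrix functions of \<open>(x, t)\<close> are curried.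
  Since \<open>\<Pi>\<close> and \<open>\<lambda>\<close> are reserved symbols of the syntax, the matrix function Pi is called \<open>P\<close> and
  the spectral parameter \<open>lam\<close>.
\<close>

type_synonym 'a mfun = "real \<Rightarrow> real \<Rightarrow> 'a"
type_synonym ('m1, 'm2) blockmat = "complex ^ ('m1 + 'm2) ^ ('m1 + 'm2)"

definition ctranspose :: "complex ^ 'c ^ 'r \<Rightarrow> complex ^ 'r ^ 'c" where
  "ctranspose M = (\<chi> i k. cnj (M $ k $ i))"

definition cscale :: "complex \<Rightarrow> complex ^ 'c ^ 'r \<Rightarrow> complex ^ 'c ^ 'r" (infixr "*\<^sub>m" 75) where
  "c *\<^sub>m M = (\<chi> i k. c * M $ i $ k)"

text \<open>The library's \<open>^\<close> (and \<open>1\<close>) on \<open>vec\<close> types is componentwise, hence a separate matrix power.\<close>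

primrec mpow :: "complex ^ 'n ^ 'n \<Rightarrow> nat \<Rightarrow> complex ^ 'n ^ 'n" where
  "mpow M 0 = mat 1"
| "mpow M (Suc k) = M ** mpow M k"

definition spectrum :: "complex ^ 'n ^ 'n \<Rightarrow> complex set" where
  "spectrum M = {z. \<not> invertible (M - mat z)}"

definition block ::
  "complex ^ 'm1 ^ 'm1 \<Rightarrow> complex ^ 'm2 ^ 'm1 \<Rightarrow> complex ^ 'm1 ^ 'm2 \<Rightarrow> complex ^ 'm2 ^ 'm2
    \<Rightarrow> ('m1::finite, 'm2::finite) blockmat" where
  "block B11 B12 B21 B22 = (\<chi> i k. case i of
      Inl r \<Rightarrow> (case k of Inl c \<Rightarrow> B11 $ r $ c | Inr c \<Rightarrow> B12 $ r $ c)
    | Inr r \<Rightarrow> (case k of Inl c \<Rightarrow> B21 $ r $ c | Inr c \<Rightarrow> B22 $ r $ c))"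

definition left_block :: "complex ^ ('m1::finite + 'm2::finite) ^ 'n \<Rightarrow> complex ^ 'm1 ^ 'n" where
  "left_block M = (\<chi> i k. M $ i $ Inl k)"

definition right_block :: "complex ^ ('m1::finite + 'm2::finite) ^ 'n \<Rightarrow> complex ^ 'm2 ^ 'n" where
  "right_block M = (\<chi> i k. M $ i $ Inr k)"

definition jmat :: "('m1::finite, 'm2::finite) blockmat" where
  "jmat = block (mat 1) 0 0 (- mat 1)"

definition rect_dom :: "ereal \<Rightarrow> ereal \<Rightarrow> ereal \<Rightarrow> (real \<times> real) set" where
  "rect_dom a b1 b2 = {(x, t). - a < ereal x \<and> ereal x < a \<and> b1 < ereal t \<and> ereal t < b2}"

abbreviation has_dx :: "'a::real_normed_vector mfun \<Rightarrow> 'a \<Rightarrow> real \<Rightarrow> real \<Rightarrow> bool" where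
  "has_dx f f' x t \<equiv> ((\<lambda>y. f y t) has_vector_derivative f') (at x)"

abbreviation has_dt :: "'a::real_normed_vector mfun \<Rightarrow> 'a \<Rightarrow> real \<Rightarrow> real \<Rightarrow> bool" where
  "has_dt f f' x t \<equiv> ((\<lambda>s. f x s) has_vector_derivative f') (at t)"

text \<open>Arbitrary where the derivative does not exist, so uses are paired with differentiability.\<close>

definition dt :: "'a::real_normed_vector mfun \<Rightarrow> 'a mfun" where
  "dt f x t = vector_derivative (\<lambda>s. f x s) (at t)"


subsection \<open>The nonlocal matrix dispersionless equations\<close>

definition nonlocal_form ::
  "(real \<times> real) set \<Rightarrow> ('m1::finite, 'm2::finite) blockmat mfun \<Rightarrow> ('m1, 'm2) blockmat mfun
    \<Rightarrow> (complex ^ 'm1 ^ 'm1) mfun \<Rightarrow> (complex ^ 'm2 ^ 'm2) mfun \<Rightarrow> (complex ^ 'm2 ^ 'm1) mfun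
    \<Rightarrow> bool" where
  "nonlocal_form E R V \<rho>1 \<rho>2 v \<longleftrightarrow> (\<forall>(x, t) \<in> E.
      R x t = block (\<rho>1 x t) 0 0 (\<rho>2 x t) \<and>
      R x t = - ctranspose (R (- x) t) \<and>
      V x t = block 0 (v x t) (ctranspose (v (- x) t)) 0)"

definition dispersionless_eqs ::
  "(real \<times> real) set \<Rightarrow> nat \<Rightarrow> ('m1::finite, 'm2::finite) blockmat mfun
    \<Rightarrow> ('m1, 'm2) blockmat mfun \<Rightarrow> bool" where
  "dispersionless_eqs E p R V \<longleftrightarrow> (\<forall>(x, t) \<in> E.
      (\<lambda>s. V x s) differentiable (at t) \<and>
      has_dx R (((-1) ^ p / 2) *\<^sub>R (V x t ** dt V x t + dt V x t ** V x t)) x t \<and>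
      has_dx (dt V) ((1 / 2) *\<^sub>R (V x t ** R x t + R x t ** V x t)) x t)"

definition G_aux ::
  "nat \<Rightarrow> ('m1::finite, 'm2::finite) blockmat mfun \<Rightarrow> complex \<Rightarrow> ('m1, 'm2) blockmat mfun" where
  "G_aux p V lam x t = (\<i> / 4 * lam) *\<^sub>m jmat - (\<i> / 2) *\<^sub>m (mpow jmat (p + 1) ** V x t)"

definition F_aux ::
  "nat \<Rightarrow> ('m1::finite, 'm2::finite) blockmat mfun \<Rightarrow> ('m1, 'm2) blockmat mfun \<Rightarrow> complex
    \<Rightarrow> ('m1, 'm2) blockmat mfun" where
  "F_aux p R V lam x t =
    (1 / lam) *\<^sub>m ((- \<i>) *\<^sub>m (jmat ** R x t) + mpow jmat p ** dt V x t)"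

definition wave_function ::
  "(real \<times> real) set \<Rightarrow> nat \<Rightarrow> ('m1::finite, 'm2::finite) blockmat mfun
    \<Rightarrow> ('m1, 'm2) blockmat mfun \<Rightarrow> complex \<Rightarrow> ('m1, 'm2) blockmat mfun \<Rightarrow> bool" where
  "wave_function E p R V lam w \<longleftrightarrow> det (w 0 0) \<noteq> 0 \<and> (\<forall>(x, t) \<in> E.
      has_dx w (G_aux p V lam x t ** w x t) x t \<and>
      has_dt w (F_aux p R V lam x t ** w x t) x t)"


subsection \<open>Linear systems generating the transformation\<close>

definition q1 :: "('m1::finite, 'm2::finite) blockmat" where
  "q1 = (- (\<i> / 4)) *\<^sub>m jmat"

definition q0 ::
  "nat \<Rightarrow> ('m1::finite, 'm2::finite) blockmat mfun \<Rightarrow> ('m1, 'm2) blockmat mfun" where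
  "q0 p V x t = (\<i> / 2) *\<^sub>m (mpow jmat (p + 1) ** V x t)"

definition Q_m1 ::
  "nat \<Rightarrow> ('m1::finite, 'm2::finite) blockmat mfun \<Rightarrow> ('m1, 'm2) blockmat mfun
    \<Rightarrow> ('m1, 'm2) blockmat mfun" where
  "Q_m1 p R V x t = \<i> *\<^sub>m (jmat ** R x t) - mpow jmat p ** dt V x t"

definition Pi_system ::
  "(real \<times> real) set \<Rightarrow> nat \<Rightarrow> ('m1::finite, 'm2::finite) blockmat mfun
    \<Rightarrow> ('m1, 'm2) blockmat mfun \<Rightarrow> complex ^ 'n ^ 'n
    \<Rightarrow> (complex ^ ('m1 + 'm2) ^ 'n) mfun \<Rightarrow> bool" where
  "Pi_system E p R V A P \<longleftrightarrow> (\<forall>(x, t) \<in> E.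
      has_dx P (P x t ** q0 p V x t + A ** P x t ** q1) x t \<and>
      has_dt P (matrix_inv A ** P x t ** Q_m1 p R V x t) x t)"

definition S_system ::
  "(real \<times> real) set \<Rightarrow> nat \<Rightarrow> ('m1::finite, 'm2::finite) blockmat mfun
    \<Rightarrow> ('m1, 'm2) blockmat mfun \<Rightarrow> complex ^ 'n ^ 'n
    \<Rightarrow> (complex ^ ('m1 + 'm2) ^ 'n) mfun \<Rightarrow> (complex ^ 'n ^ 'n) mfun \<Rightarrow> bool" where
  "S_system E p R V A P S \<longleftrightarrow> (\<forall>(x, t) \<in> E.
      has_dx S (\<i> *\<^sub>m (P x t ** q1 ** mpow jmat p ** ctranspose (P (- x) t))) x t \<and>
      has_dt S (\<i> *\<^sub>m (matrix_inv A ** P x t ** Q_m1 p R V x t ** mpow jmat p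
                  ** ctranspose (P (- x) t) ** matrix_inv (ctranspose A))) x t)"

text \<open>Existence, and uniqueness up to values outside \<open>E\<close>.\<close>

definition well_defined_on :: "(real \<times> real) set \<Rightarrow> ('a mfun \<Rightarrow> bool) \<Rightarrow> bool" where
  "well_defined_on E P \<longleftrightarrow>
    (\<exists>f. P f) \<and> (\<forall>f g. P f \<longrightarrow> P g \<longrightarrow> (\<forall>(x, t) \<in> E. f x t = g x t))"


subsection \<open>Transformed functions (meaningful where \<open>S\<close> is invertible)\<close>

definition X_m1 ::
  "nat \<Rightarrow> complex ^ 'n ^ 'n \<Rightarrow> (complex ^ ('m1::finite + 'm2::finite) ^ 'n) mfun
    \<Rightarrow> (complex ^ 'n ^ 'n) mfun \<Rightarrow> ('m1, 'm2) blockmat mfun" where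
  "X_m1 p A P S x t = \<i> *\<^sub>m (mpow jmat p ** ctranspose (P (- x) t) ** matrix_inv (S x t)
      ** matrix_inv A ** P x t)"

definition Y_m1 ::
  "nat \<Rightarrow> complex ^ 'n ^ 'n \<Rightarrow> (complex ^ ('m1::finite + 'm2::finite) ^ 'n) mfun
    \<Rightarrow> (complex ^ 'n ^ 'n) mfun \<Rightarrow> ('m1, 'm2) blockmat mfun" where
  "Y_m1 p A P S x t = (- \<i>) *\<^sub>m (mpow jmat p ** ctranspose (P (- x) t)
      ** ctranspose (matrix_inv A) ** matrix_inv (S x t) ** P x t)"

definition Q_m1_tilde ::
  "nat \<Rightarrow> ('m1::finite, 'm2::finite) blockmat mfun \<Rightarrow> ('m1, 'm2) blockmat mfun
    \<Rightarrow> complex ^ 'n ^ 'n \<Rightarrow> (complex ^ ('m1 + 'm2) ^ 'n) mfun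
    \<Rightarrow> (complex ^ 'n ^ 'n) mfun \<Rightarrow> ('m1, 'm2) blockmat mfun" where
  "Q_m1_tilde p R V A P S x t =
    (mat 1 - X_m1 p A P S x t) ** Q_m1 p R V x t ** (mat 1 + Y_m1 p A P S x t)"

definition R_tilde ::
  "nat \<Rightarrow> ('m1::finite, 'm2::finite) blockmat mfun \<Rightarrow> ('m1, 'm2) blockmat mfun
    \<Rightarrow> complex ^ 'n ^ 'n \<Rightarrow> (complex ^ ('m1 + 'm2) ^ 'n) mfun
    \<Rightarrow> (complex ^ 'n ^ 'n) mfun \<Rightarrow> ('m1, 'm2) blockmat mfun" where
  "R_tilde p R V A P S x t = (1 / (2 * \<i>)) *\<^sub>m
    (Q_m1_tilde p R V A P S x t ** jmat + jmat ** Q_m1_tilde p R V A P S x t)"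

definition V_tilde ::
  "('m1::finite, 'm2::finite) blockmat mfun \<Rightarrow> (complex ^ ('m1 + 'm2) ^ 'n) mfun
    \<Rightarrow> (complex ^ 'n ^ 'n) mfun \<Rightarrow> ('m1, 'm2) blockmat mfun" where
  "V_tilde V P S x t = V x t + (\<i> / 2) *\<^sub>m
    (ctranspose (P (- x) t) ** matrix_inv (S x t) ** P x t
     - jmat ** ctranspose (P (- x) t) ** matrix_inv (S x t) ** P x t ** jmat)"

definition v_tilde ::
  "(complex ^ 'm2 ^ 'm1) mfun \<Rightarrow> (complex ^ ('m1::finite + 'm2::finite) ^ 'n) mfun
    \<Rightarrow> (complex ^ 'n ^ 'n) mfun \<Rightarrow> (complex ^ 'm2 ^ 'm1) mfun" where
  "v_tilde v P S x t = v x t + \<i> *\<^sub>m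
    (ctranspose (left_block (P (- x) t)) ** matrix_inv (S x t) ** right_block (P x t))"

definition w_A ::
  "nat \<Rightarrow> complex ^ 'n ^ 'n \<Rightarrow> (complex ^ ('m1::finite + 'm2::finite) ^ 'n) mfun
    \<Rightarrow> (complex ^ 'n ^ 'n) mfun \<Rightarrow> complex \<Rightarrow> ('m1, 'm2) blockmat mfun" where
  "w_A p A P S lam x t = mat 1 - \<i> *\<^sub>m (mpow jmat p ** ctranspose (P (- x) t)
      ** matrix_inv (S x t) ** matrix_inv (A - mat lam) ** P x t)"

end

theory Submission
  imports Defs
begin

text \<open>
  The two equations for \<open>R\<close> and \<open>V\<close> are the zero curvature condition \<open>G\<^sub>t - F\<^sub>x + [G, F] = 0\<close> of the
  pair \<open>w\<^sub>x = G w\<close>, \<open>w\<^sub>t = F w\<close>. With \<open>G = - (q\<^sub>0 + \<lambda> q\<^sub>1)\<close> and \<open>F = - Q / \<lambda>\<close>, \<open>Q = Q\<^sub>-\<^sub>1\<close>, that condition splits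
  into \<open>(q\<^sub>0)\<^sub>t = q\<^sub>1 Q - Q q\<^sub>1\<close>, which holds by the mere form of the coefficients, and
  \<open>Q\<^sub>x = Q q\<^sub>0 - q\<^sub>0 Q\<close>, whose parts commuting and anticommuting with \<open>j\<close> are the equations for \<open>R\<close> and for
  \<open>V\<^sub>t\<close> (\<open>zero_curvature_algebra\<close>).

  Well-definedness. The systems for \<open>w\<close> and for \<open>\<Pi>\<close> are compatible pairs of linear systems, and the
  right-hand sides for \<open>S\<close> form a closed differential. Since \<open>V\<close> is merely continuous in \<open>x\<close>, the form
  of the Frobenius theorem that is needed (\<open>frobenius_linear\<close>) asks for a \<open>t\<close>-derivative of \<open>G\<close> and an
  \<open>x\<close>-derivative of \<open>F\<close> only. One solves along the \<open>t\<close>-axis and then along each line \<open>t = const\<close>;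
  that the result solves the \<open>t\<close>-equation follows from Gronwall's inequality, applied to a difference
  quotient in \<open>t\<close> (\<open>has_dt_from_compatibility\<close>).

  Transformation. The symmetries of \<open>R\<close> and \<open>V\<close> under \<open>x \<mapsto> -x\<close> turn the reflected matrix function
  \<open>N(x,t) = j\<^sup>p \<Pi>(-x,t)\<^sup>*\<close> into a solution of linear systems with coefficients at \<open>(x,t)\<close> itself
  (\<open>has_dx_N\<close>, \<open>has_dt_N\<close>). Hence both sides of \<open>A S + S A\<^sup>* = \<i> \<Pi> N\<close> have the same gradient, and the
  identity spreads from the origin to the whole domain (\<open>node_identity\<close>). So the five matrices form an
  S-node, and \<open>w\<^sub>A\<close> is its transfer matrix function. The algebra of S-nodes (locale \<open>s_node\<close>)
  gives \<open>(w\<^sub>A)\<^sub>x = G' w\<^sub>A - w\<^sub>A G\<close> and \<open>(w\<^sub>A)\<^sub>t = F' w\<^sub>A - w\<^sub>A F\<close>, where \<open>G'\<close> and \<open>F'\<close> are formed with the dressed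
  coefficients \<open>q\<^sub>0'\<close> and \<open>Q'\<close>. It remains to see that \<open>q\<^sub>0'\<close> and \<open>Q'\<close> arise from the
  transformed \<open>R\<close> and \<open>V\<close> exactly as \<open>q\<^sub>0\<close> and \<open>Q\<close> do from \<open>R\<close> and \<open>V\<close>. For \<open>Q'\<close> this rests on
  \<open>(X\<^sub>0)\<^sub>t = Q - Q'\<close> with \<open>X\<^sub>0 = \<i> j\<^sup>p \<Pi>(-x,t)\<^sup>* S\<inverse> \<Pi>\<close>, which identifies the part of \<open>Q'\<close> that anticommutes with
  \<open>j\<close> as \<open>- j\<^sup>p\<close> times the \<open>t\<close>-derivative of the transformed \<open>V\<close> (\<open>Q_m1_of_transformed\<close>).

  At \<open>\<lambda> = 0\<close> the transfer function is \<open>W = I - X\<^sub>-\<^sub>1\<close>, with inverse \<open>I + Y\<^sub>-\<^sub>1\<close>, so that \<open>Q' = W Q W\<inverse>\<close> and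
  \<open>W\<^sub>x = W q\<^sub>0 - q\<^sub>0' W\<close>. Therefore \<open>Q\<^sub>x = Q q\<^sub>0 - q\<^sub>0 Q\<close> implies \<open>Q'\<^sub>x = Q' q\<^sub>0' - q\<^sub>0' Q'\<close>, and reading this
  backwards one obtains the transformed equations (\<open>transformed_equations\<close>). The nonlocal symmetries of
  the transformed functions come from \<open>S(-x,t)\<^sup>* = - S(x,t)\<close>, again by comparison of gradients
  (\<open>S_antisymmetric\<close>).
\<close>

section \<open>Complex matrices\<close>

lemma matrix_mult_uminus_left: "(- A) ** B = - (A ** B)" for A :: "complex ^ 'm ^ 'n"
  by (simp add: matrix_matrix_mult_def vec_eq_iff sum_negf)

lemma matrix_mult_uminus_right: "A ** (- B) = - (A ** B)" for A :: "complex ^ 'm ^ 'n"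
  by (simp add: matrix_matrix_mult_def vec_eq_iff sum_negf)

lemma matrix_mult_add_left: "(A + B) ** C = A ** C + B ** C" for A :: "complex ^ 'm ^ 'n"
  by (simp add: matrix_matrix_mult_def vec_eq_iff sum.distrib distrib_right)

lemma matrix_mult_diff_left: "(A - B) ** C = A ** C - B ** C" for A :: "complex ^ 'm ^ 'n"
  by (simp add: matrix_matrix_mult_def vec_eq_iff sum_subtractf left_diff_distrib)

lemma matrix_mult_diff_right: "A ** (B - C) = A ** B - A ** C" for A :: "complex ^ 'm ^ 'n"
  by (simp add: matrix_matrix_mult_def vec_eq_iff sum_subtractf right_diff_distrib)

lemma matrix_mult_cscale_left: "(c *\<^sub>m A) ** B = c *\<^sub>m (A ** B)"
  by (simp add: matrix_matrix_mult_def cscale_def vec_eq_iff sum_distrib_left mult.assoc)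

lemma matrix_mult_cscale_right: "A ** (c *\<^sub>m B) = c *\<^sub>m (A ** B)"
  by (simp add: matrix_matrix_mult_def cscale_def vec_eq_iff sum_distrib_left mult_ac)

lemma matrix_mult_zero_left: "0 ** B = 0" for B :: "complex ^ 'k ^ 'm"
  by (simp add: matrix_matrix_mult_def vec_eq_iff)

lemma matrix_mult_zero_right: "B ** 0 = 0" for B :: "complex ^ 'k ^ 'm"
  by (simp add: matrix_matrix_mult_def vec_eq_iff)

lemma cscale_cscale: "c *\<^sub>m d *\<^sub>m A = (c * d) *\<^sub>m A"
  by (simp add: cscale_def vec_eq_iff)

lemma cscale_one: "1 *\<^sub>m A = A"
  by (simp add: cscale_def vec_eq_iff)

lemma cscale_zero_left: "0 *\<^sub>m A = 0"
  by (simp add: cscale_def vec_eq_iff)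

lemma cscale_zero_right: "c *\<^sub>m 0 = 0"
  by (simp add: cscale_def vec_eq_iff)

lemma cscale_add: "c *\<^sub>m (A + B) = c *\<^sub>m A + c *\<^sub>m B"
  by (simp add: cscale_def vec_eq_iff distrib_left)

lemma cscale_diff: "c *\<^sub>m (A - B) = c *\<^sub>m A - c *\<^sub>m B"
  by (simp add: cscale_def vec_eq_iff right_diff_distrib)

lemma cscale_uminus: "c *\<^sub>m (- A) = - (c *\<^sub>m A)"
  by (simp add: cscale_def vec_eq_iff)

lemma uminus_cscale: "(- c) *\<^sub>m A = - (c *\<^sub>m A)"
  by (simp add: cscale_def vec_eq_iff)

lemma cscale_add_left: "(c + d) *\<^sub>m A = c *\<^sub>m A + d *\<^sub>m A"
  by (simp add: cscale_def vec_eq_iff distrib_right)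

lemma cscale_double: "c *\<^sub>m M + c *\<^sub>m M = (2 * c) *\<^sub>m M"
  by (simp add: cscale_def vec_eq_iff)

lemma scaleR_eq_cscale: "r *\<^sub>R A = complex_of_real r *\<^sub>m A"
  by (simp add: cscale_def vec_eq_iff) (simp add: scaleR_conv_of_real)

text \<open>Rewriting with these rules brings a matrix expression into a linear combination of products
  that associate to the right.\<close>

lemmas mat_expand =
  matrix_mul_assoc[symmetric] matrix_mult_uminus_left matrix_mult_uminus_right
  matrix_add_ldistrib matrix_mult_add_left matrix_mult_diff_left matrix_mult_diff_right
  matrix_mult_cscale_left matrix_mult_cscale_right matrix_mult_zero_left matrix_mult_zero_right
  cscale_cscale cscale_one cscale_zero_left cscale_zero_right cscale_add cscale_diff cscale_uminus
  uminus_cscale matrix_mul_lid matrix_mul_rid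

text \<open>The form in which a product rule applies inside a product that associates to the right.\<close>

lemma mult_eq_extend: "A ** B = C \<Longrightarrow> A ** (B ** D) = C ** D"
  by (simp add: matrix_mul_assoc)

lemma ctranspose_mult: "ctranspose (A ** B) = ctranspose B ** ctranspose A"
  by (simp add: ctranspose_def matrix_matrix_mult_def vec_eq_iff mult.commute)

lemma ctranspose_cscale: "ctranspose (c *\<^sub>m A) = cnj c *\<^sub>m ctranspose A"
  by (simp add: ctranspose_def cscale_def vec_eq_iff)

lemma ctranspose_add: "ctranspose (A + B) = ctranspose A + ctranspose B"
  by (simp add: ctranspose_def vec_eq_iff)

lemma ctranspose_diff: "ctranspose (A - B) = ctranspose A - ctranspose B"
  by (simp add: ctranspose_def vec_eq_iff)

lemma ctranspose_uminus: "ctranspose (- A) = - ctranspose A"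
  by (simp add: ctranspose_def vec_eq_iff)

lemma ctranspose_ctranspose: "ctranspose (ctranspose A) = A"
  by (simp add: ctranspose_def vec_eq_iff)

lemma ctranspose_mat: "ctranspose (mat c) = mat (cnj c)"
  by (auto simp: ctranspose_def vec_eq_iff mat_def)

lemmas ctranspose_expand = ctranspose_mult ctranspose_cscale ctranspose_add ctranspose_diff
  ctranspose_uminus ctranspose_ctranspose ctranspose_mat

lemma matrix_inv_right: "invertible A \<Longrightarrow> A ** matrix_inv A = mat 1"
  and matrix_inv_left: "invertible A \<Longrightarrow> matrix_inv A ** A = mat 1"
  unfolding invertible_def matrix_inv_def by (rule someI2_ex; blast)+

lemma matrix_inv_unique:
  assumes "A ** B = mat 1" "B ** A = mat 1"
  shows "matrix_inv A = B"
  using assms by (metis invertible_def matrix_inv_left matrix_mul_assoc matrix_mul_lid matrix_mul_rid)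

lemma invertible_ctranspose:
  assumes "invertible A"
  shows "invertible (ctranspose A)"
    and "matrix_inv (ctranspose A) = ctranspose (matrix_inv A)"
proof -
  have "ctranspose A ** ctranspose (matrix_inv A) = mat 1"
       "ctranspose (matrix_inv A) ** ctranspose A = mat 1"
    using assms by (simp_all flip: ctranspose_mult add: matrix_inv_left matrix_inv_right ctranspose_mat)
  then show "invertible (ctranspose A)" "matrix_inv (ctranspose A) = ctranspose (matrix_inv A)"
    by (auto simp: invertible_def intro: matrix_inv_unique)
qed

lemma matrix_inv_uminus:
  fixes A :: "complex ^ 'n ^ 'n"
  assumes "invertible A"
  shows "invertible (- A)" "matrix_inv (- A) = - matrix_inv A"
proof -
  have "(- A) ** (- matrix_inv A) = mat 1" "(- matrix_inv A) ** (- A) = mat 1"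
    using assms by (simp_all add: mat_expand matrix_inv_left matrix_inv_right)
  then show "invertible (- A)" "matrix_inv (- A) = - matrix_inv A"
    by (auto simp: invertible_def intro: matrix_inv_unique)
qed

section \<open>Calculus of matrix functions\<close>

lemma bounded_bilinear_matrix_mult:
  "bounded_bilinear ((**) :: complex ^ 'm ^ 'n \<Rightarrow> complex ^ 'k ^ 'm \<Rightarrow> complex ^ 'k ^ 'n)"
  unfolding bilinear_conv_bounded_bilinear[symmetric] bilinear_def
  by (auto intro!: linearI simp: mat_expand scaleR_eq_cscale)

lemma bounded_linear_cscale: "bounded_linear (\<lambda>A :: complex ^ 'm ^ 'n. c *\<^sub>m A)"
  unfolding linear_conv_bounded_linear[symmetric]
  by (auto intro!: linearI simp: mat_expand scaleR_eq_cscale mult.commute)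

lemma bounded_linear_ctranspose: "bounded_linear (ctranspose :: complex ^ 'm ^ 'n \<Rightarrow> _)"
  unfolding linear_conv_bounded_linear[symmetric]
  by (auto intro!: linearI simp: ctranspose_expand scaleR_eq_cscale)

lemmas has_vector_derivative_matrix_mult [derivative_intros] =
  bounded_bilinear.has_vector_derivative[OF bounded_bilinear_matrix_mult]

lemmas has_vector_derivative_cscale [derivative_intros] =
  bounded_linear.has_vector_derivative[OF bounded_linear_cscale]

lemmas has_vector_derivative_ctranspose [derivative_intros] =
  bounded_linear.has_vector_derivative[OF bounded_linear_ctranspose]

lemmas continuous_on_matrix_mult [continuous_intros] =
  bounded_bilinear.continuous_on[OF bounded_bilinear_matrix_mult]

lemmas continuous_on_cscale [continuous_intros] =
  bounded_linear.continuous_on[OF bounded_linear_cscale]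

lemmas continuous_on_ctranspose [continuous_intros] =
  bounded_linear.continuous_on[OF bounded_linear_ctranspose]

lemma has_vector_derivative_iff_quotient:
  fixes f :: "real \<Rightarrow> 'a::real_normed_vector"
  shows "(f has_vector_derivative f') (at x) \<longleftrightarrow>
    ((\<lambda>y. (1 / (y - x)) *\<^sub>R (f y - f x)) \<longlongrightarrow> f') (at x)"
proof -
  have *: "norm (f y - f x - (y - x) *\<^sub>R f') / norm (y - x) =
      norm ((1 / (y - x)) *\<^sub>R (f y - f x) - f')" if "y \<noteq> x" for y
  proof -
    have "(1 / (y - x)) *\<^sub>R (f y - f x) - f' = (1 / (y - x)) *\<^sub>R (f y - f x - (y - x) *\<^sub>R f')"
      using that by (simp add: scaleR_diff_right)
    then show ?thesis by simp
  qed
  have "(f has_vector_derivative f') (at x) \<longleftrightarrow>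
      ((\<lambda>y. norm (f y - f x - (y - x) *\<^sub>R f') / norm (y - x)) \<longlongrightarrow> 0) (at x)"
    unfolding has_vector_derivative_def has_derivative_iff_norm
    by (simp add: bounded_linear_scaleR_left)
  also have "\<dots> \<longleftrightarrow> ((\<lambda>y. norm ((1 / (y - x)) *\<^sub>R (f y - f x) - f')) \<longlongrightarrow> 0) (at x)"
    by (rule tendsto_cong, unfold eventually_at_filter, rule always_eventually) (use * in blast)
  also have "\<dots> \<longleftrightarrow> ((\<lambda>y. (1 / (y - x)) *\<^sub>R (f y - f x)) \<longlongrightarrow> f') (at x)"
    by (simp add: tendsto_norm_zero_iff LIM_zero_iff)
  finally show ?thesis .
qed

lemma tendsto_det:
  fixes S :: "'a \<Rightarrow> complex ^ 'n ^ 'n"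
  assumes "(S \<longlongrightarrow> M) F"
  shows "((\<lambda>y. det (S y)) \<longlongrightarrow> det M) F"
  unfolding det_def by (intro tendsto_intros assms)

lemma eventually_invertible:
  fixes S :: "'a \<Rightarrow> complex ^ 'n ^ 'n"
  assumes "(S \<longlongrightarrow> M) F" "invertible M"
  shows "\<forall>\<^sub>F y in F. invertible (S y)"
  using tendsto_imp_eventually_ne[OF tendsto_det[OF assms(1)]] assms(2)
  by (simp add: invertible_det_nz)

text \<open>The identity \<open>Y - X = X (X\<inverse> - Y\<inverse>) Y\<close> for inverses reduces both continuity and
  differentiability of the inverse to those of the matrix itself.\<close>

lemma matrix_inv_diff:
  fixes M N :: "complex ^ 'n ^ 'n"
  assumes "invertible M" "invertible N"
  shows "matrix_inv M - matrix_inv N = - (matrix_inv M ** (M - N) ** matrix_inv N)"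
  using assms by (simp add: mat_expand matrix_inv_left matrix_inv_right
      matrix_inv_left[THEN mult_eq_extend])

text \<open>The estimate \<open>\<bar>Y - Z\<bar> \<le> \<bar>Y\<bar> d\<close> with \<open>d \<rightarrow> 0\<close> first bounds the inverses \<open>Y\<close> by \<open>2 \<bar>Z\<bar>\<close> near the
  limit, and then shows that they converge to \<open>Z\<close>.\<close>

lemma tendsto_matrix_inv:
  fixes S :: "'a \<Rightarrow> complex ^ 'n ^ 'n"
  assumes S: "(S \<longlongrightarrow> M) F" and M: "invertible M"
  shows "((\<lambda>y. matrix_inv (S y)) \<longlongrightarrow> matrix_inv M) F"
proof -
  interpret bb: bounded_bilinear "(**) :: complex ^ 'n ^ 'n \<Rightarrow> complex ^ 'n ^ 'n \<Rightarrow> complex ^ 'n ^ 'n"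
    by (rule bounded_bilinear_matrix_mult)
  obtain K where K: "K > 0" "\<And>(a :: complex ^ 'n ^ 'n) (b :: complex ^ 'n ^ 'n). norm (a ** b) \<le> norm a * norm b * K"
    using bb.pos_bounded by blast
  let ?Z = "matrix_inv M"
  define d where "d y = norm ((S y - M) ** ?Z) * K" for y
  have "((\<lambda>y. (S y - M) ** ?Z) \<longlongrightarrow> (M - M) ** ?Z) F"
    by (intro bb.tendsto tendsto_intros S)
  then have "((\<lambda>y. norm ((S y - M) ** ?Z) * K) \<longlongrightarrow> norm ((M - M) ** ?Z) * K) F"
    by (intro tendsto_intros)
  then have d0: "(d \<longlongrightarrow> 0) F"
    unfolding d_def by (simp add: matrix_mult_zero_left)
  have diff: "\<forall>\<^sub>F y in F. norm (matrix_inv (S y) - ?Z) \<le> norm (matrix_inv (S y)) * d y"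
    using eventually_invertible[OF S M]
  proof eventually_elim
    case (elim y)
    have "norm (matrix_inv (S y) - ?Z) = norm (matrix_inv (S y) ** ((S y - M) ** ?Z))"
      using matrix_inv_diff[OF elim M] by (simp add: matrix_mul_assoc)
    also have "\<dots> \<le> norm (matrix_inv (S y)) * norm ((S y - M) ** ?Z) * K"
      by (rule K)
    finally show ?case by (simp add: d_def mult.assoc)
  qed
  moreover have "\<forall>\<^sub>F y in F. d y < 1/2"
    by (rule order_tendstoD(2)[OF d0]) simp
  ultimately have "\<forall>\<^sub>F y in F. norm (matrix_inv (S y) - ?Z) \<le> 2 * norm ?Z * d y"
  proof eventually_elim
    case (elim y)
    have d: "d y \<ge> 0" using K(1) by (simp add: d_def)
    have "norm (matrix_inv (S y)) \<le> norm ?Z + norm (matrix_inv (S y)) * d y"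
      using elim(1) norm_triangle_ineq2[of "matrix_inv (S y)" ?Z] by linarith
    also have "\<dots> \<le> norm ?Z + norm (matrix_inv (S y)) * (1/2)"
      using elim(2) by (intro add_left_mono mult_left_mono) auto
    finally have "norm (matrix_inv (S y)) \<le> 2 * norm ?Z" by simp
    then have "norm (matrix_inv (S y)) * d y \<le> 2 * norm ?Z * d y"
      using d by (rule mult_right_mono)
    with elim(1) show ?case by linarith
  qed
  moreover have "((\<lambda>y. 2 * norm ?Z * d y) \<longlongrightarrow> 0) F"
    using tendsto_mult_right_zero[OF d0] by simp
  ultimately have "((\<lambda>y. matrix_inv (S y) - ?Z) \<longlongrightarrow> 0) F"
    by (rule Lim_null_comparison)
  then show ?thesis by (simp add: LIM_zero_iff)
qed

lemma has_vector_derivative_matrix_inv: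
  fixes S :: "real \<Rightarrow> complex ^ 'n ^ 'n"
  assumes S: "(S has_vector_derivative S') (at x)" and inv: "invertible (S x)"
  shows "((\<lambda>y. matrix_inv (S y)) has_vector_derivative
    - (matrix_inv (S x) ** S' ** matrix_inv (S x))) (at x)"
proof -
  interpret bb: bounded_bilinear "(**) :: complex ^ 'n ^ 'n \<Rightarrow> complex ^ 'n ^ 'n \<Rightarrow> complex ^ 'n ^ 'n"
    by (rule bounded_bilinear_matrix_mult)
  have lim: "(S \<longlongrightarrow> S x) (at x)"
    using has_vector_derivative_continuous[OF S] by (simp add: continuous_at)
  have "((\<lambda>y. - (matrix_inv (S y) ** ((1 / (y - x)) *\<^sub>R (S y - S x)) ** matrix_inv (S x)))
      \<longlongrightarrow> - (matrix_inv (S x) ** S' ** matrix_inv (S x))) (at x)"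
    using S unfolding has_vector_derivative_iff_quotient
    by (intro tendsto_intros bb.tendsto tendsto_matrix_inv lim inv)
  moreover have "\<forall>\<^sub>F y in at x. - (matrix_inv (S y) ** ((1 / (y - x)) *\<^sub>R (S y - S x)) ** matrix_inv (S x))
      = (1 / (y - x)) *\<^sub>R (matrix_inv (S y) - matrix_inv (S x))"
    using eventually_invertible[OF lim inv]
    by eventually_elim (simp add: matrix_inv_diff[OF _ inv] bb.scaleR_left bb.scaleR_right)
  ultimately show ?thesis
    unfolding has_vector_derivative_iff_quotient by (rule Lim_transform_eventually)
qed

section \<open>Linear differential equations with a parameter\<close>

lemma compact_subinterval_with_points_inside:
  fixes X :: "real set"
  assumes "open X" "convex X" "a \<in> X" "b \<in> X"
  obtains l r where "l < a" "l < b" "a < r" "b < r" "{l..r} \<subseteq> X"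
proof -
  have m: "min a b \<in> X" "max a b \<in> X" using assms by (auto simp: min_def max_def)
  obtain e1 where e1: "e1 > 0" "cball (min a b) e1 \<subseteq> X"
    using assms(1) m by (meson open_contains_cball)
  obtain e2 where e2: "e2 > 0" "cball (max a b) e2 \<subseteq> X"
    using assms(1) m by (meson open_contains_cball)
  have "min a b - e1 \<in> X" "max a b + e2 \<in> X"
    using e1 e2 by (auto simp: dist_real_def subset_iff)
  then have "closed_segment (min a b - e1) (max a b + e2) \<subseteq> X"
    using assms(2) by (simp add: closed_segment_subset)
  moreover have "min a b - e1 \<le> max a b + e2" using e1(1) e2(1) by linarith
  ultimately have "{min a b - e1..max a b + e2} \<subseteq> X"
    by (simp add: closed_segment_eq_real_ivl)
  with e1 e2 show ?thesis by (intro that[of "min a b - e1" "max a b + e2"]) auto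
qed

lemma continuous_on_compact_norm_bound:
  fixes f :: "'a::topological_space \<Rightarrow> 'b::real_normed_vector"
  assumes "continuous_on S f" "compact S"
  obtains K where "K > 0" "\<And>z. z \<in> S \<Longrightarrow> norm (f z) \<le> K"
  using compact_imp_bounded[OF compact_continuous_image[OF assms]]
  unfolding bounded_pos by auto

lemma convex_zero_scale:
  fixes X :: "real set"
  assumes "convex X" "0 \<in> X" "x \<in> X" "0 \<le> s" "s \<le> 1"
  shows "s * x \<in> X"
  using convexD[OF assms(1) assms(2,3), of "1 - s" s] assms by simp

text \<open>The integral of \<open>f\<close> from \<open>0\<close> to \<open>x\<close>, written over a fixed interval; \<open>x\<close> may be negative.\<close>

lemma scaled_integral_has_vector_derivative:
  fixes f :: "real \<Rightarrow> 'a::banach"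
  assumes X: "open X" "convex X" "0 \<in> X" and f: "continuous_on X f" and x: "x \<in> X"
  shows "((\<lambda>x. x *\<^sub>R integral {0..1} (\<lambda>s. f (s * x))) has_vector_derivative f x) (at x)"
proof -
  obtain l r where lr: "l < 0" "l < x" "0 < r" "x < r" "{l..r} \<subseteq> X"
    using compact_subinterval_with_points_inside[OF X(1,2,3) x] .
  obtain g where g: "\<And>y. y \<in> {l..r} \<Longrightarrow> (g has_vector_derivative f y) (at y within {l..r})"
    using antiderivative_continuous[OF continuous_on_subset[OF f lr(5)]] by blast
  have eq: "y *\<^sub>R integral {0..1} (\<lambda>s. f (s * y)) = g y - g 0" if y: "y \<in> {l..r}" for y
  proof -
    have sub: "(\<lambda>s. s * y) ` {0..1} \<subseteq> {l..r}"
      using convex_zero_scale[of "{l..r}" y] y lr by auto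
    have "((\<lambda>s. y *\<^sub>R f (s * y)) has_integral (g (1 * y) - g (0 * y))) {0..1}"
    proof (rule fundamental_theorem_of_calculus)
      fix s :: real assume s: "s \<in> {0..1}"
      have "(g has_vector_derivative f (s * y)) (at (s * y) within (\<lambda>s. s * y) ` {0..1})"
        using g[of "s * y"] sub s by (meson has_vector_derivative_within_subset image_subset_iff)
      moreover have "((\<lambda>s. s * y) has_vector_derivative y) (at s within {0..1})"
        by (auto intro!: derivative_eq_intros)
      ultimately show "((\<lambda>s. g (s * y)) has_vector_derivative y *\<^sub>R f (s * y)) (at s within {0..1})"
        using vector_diff_chain_within[of "\<lambda>s. s * y" y s "{0..1}" g "f (s * y)"]
        by (simp add: o_def)
    qed simp
    from integral_unique[OF this] show ?thesis
      by (simp only: integral_cmul) simp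
  qed
  have "(g has_vector_derivative f x) (at x within {l<..<r})"
    using g[of x] lr(2,4)
    by (meson atLeastAtMost_iff greaterThanLessThan_subseteq_atLeastAtMost_iff
        has_vector_derivative_within_subset less_eq_real_def order_refl)
  then have "(g has_vector_derivative f x) (at x)"
    using lr(2,4) by (simp add: at_within_open[of x "{l<..<r}"])
  then have "((\<lambda>x. g x - g 0) has_vector_derivative f x) (at x)"
    by (auto intro!: derivative_eq_intros)
  then show ?thesis
    by (rule has_vector_derivative_transform_within_open[where S = "{l<..<r}"])
      (use lr(2,4) eq in auto)
qed

lemma scaled_integral_continuous_on:
  fixes f :: "real \<Rightarrow> real \<Rightarrow> 'a::banach"
  assumes X: "convex X" "0 \<in> X" and f: "continuous_on (X \<times> T) (\<lambda>(x, t). f x t)"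
  shows "continuous_on (X \<times> T) (\<lambda>(x, t). x *\<^sub>R integral {0..1} (\<lambda>s. f (s * x) t))"
proof -
  have "continuous_on ((X \<times> T) \<times> cbox 0 1) (\<lambda>(z, s). f (s * fst z) (snd z))"
  proof -
    have "continuous_on ((X \<times> T) \<times> cbox 0 (1::real)) (\<lambda>w. (snd w * fst (fst w), snd (fst w)))"
      by (intro continuous_intros)
    then have "continuous_on ((X \<times> T) \<times> cbox 0 (1::real))
        (\<lambda>w. (\<lambda>(x, t). f x t) (snd w * fst (fst w), snd (fst w)))"
      by (rule continuous_on_compose2[OF f]) (use X in \<open>auto intro!: convex_zero_scale\<close>)
    then show ?thesis by (simp add: case_prod_unfold)
  qed
  then have "continuous_on (X \<times> T) (\<lambda>z. integral (cbox 0 1) (\<lambda>s. f (s * fst z) (snd z)))"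
    by (rule integral_continuous_on_param)
  then show ?thesis
    unfolding case_prod_unfold by (intro continuous_intros) simp
qed

text \<open>The terms of the Neumann series of \<open>u(x,t) = c(t) + \<integral>\<^bsub>0\<^esub>\<^bsup>x\<^esup> G(y,t) u(y,t) dy\<close>, after the
  substitution \<open>y = s x\<close>.\<close>

primrec neumann_term ::
  "(real \<Rightarrow> real \<Rightarrow> 'a::banach \<Rightarrow>\<^sub>L 'a) \<Rightarrow> (real \<Rightarrow> 'a) \<Rightarrow> nat \<Rightarrow> real \<Rightarrow> real \<Rightarrow> 'a" where
  "neumann_term G c 0 x t = c t"
| "neumann_term G c (Suc k) x t =
     x *\<^sub>R integral {0..1} (\<lambda>s. G (s * x) t (neumann_term G c k (s * x) t))"

lemma continuous_on_neumann_term: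
  assumes X: "convex X" "0 \<in> X" and G: "continuous_on (X \<times> T) (\<lambda>(x, t). G x t)"
    and c: "continuous_on T c"
  shows "continuous_on (X \<times> T) (\<lambda>(x, t). neumann_term G c k x t)"
proof (induction k)
  case 0
  have "continuous_on (X \<times> T) (\<lambda>z. c (snd z))"
    by (rule continuous_on_compose2[OF c]) (auto intro: continuous_intros)
  then show ?case by (simp add: case_prod_unfold)
next
  case (Suc k)
  have "continuous_on (X \<times> T) (\<lambda>(x, t). G x t (neumann_term G c k x t))"
    using G Suc unfolding case_prod_unfold by (intro continuous_intros)
  from scaled_integral_continuous_on[OF X this] show ?case by simp
qed

lemma continuous_on_along_ray:
  fixes X :: "real set"
  assumes X: "convex X" "0 \<in> X" and h: "continuous_on (X \<times> T) (\<lambda>(x, t). h x t)"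
    and xt: "x \<in> X" "t \<in> T"
  shows "continuous_on {0..1} (\<lambda>s. h (s * x) t)"
proof -
  have "(\<lambda>s. (s * x, t)) ` {0..1} \<subseteq> X \<times> T"
    using convex_zero_scale[OF X xt(1)] xt(2) by auto
  then have "continuous_on {0..1} (\<lambda>s. (\<lambda>(x, t). h x t) (s * x, t))"
    by (intro continuous_on_compose2[OF h] continuous_intros)
  then show ?thesis by simp
qed

text \<open>Each integration of a bound proportional to \<open>\<bar>x\<bar>\<^sup>k\<close> gains the factor \<open>K \<bar>x\<bar> / (k + 1)\<close>.\<close>

lemma norm_neumann_term_le:
  fixes G :: "real \<Rightarrow> real \<Rightarrow> 'a::banach \<Rightarrow>\<^sub>L 'a"
  assumes X: "convex X" "0 \<in> X" and G: "continuous_on (X \<times> T) (\<lambda>(x, t). G x t)"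
    and c: "continuous_on T c"
    and K: "\<And>x t. x \<in> X \<Longrightarrow> t \<in> T \<Longrightarrow> norm (G x t) \<le> K" and C: "\<And>t. t \<in> T \<Longrightarrow> norm (c t) \<le> C"
    and xt: "x \<in> X" "t \<in> T"
  shows "norm (neumann_term G c k x t) \<le> C * ((K * \<bar>x\<bar>) ^ k / fact k)"
  using xt
proof (induction k arbitrary: x)
  case 0
  then show ?case using C by simp
next
  case (Suc k)
  let ?v = "\<lambda>s. G (s * x) t (neumann_term G c k (s * x) t)"
  let ?D = "K * C * (K * \<bar>x\<bar>) ^ k / fact k"
  have K0: "K \<ge> 0" using K[OF Suc.prems] norm_ge_zero order_trans by blast
  have "((\<lambda>s. ?D * s ^ k) has_integral (?D * (1 ^ Suc k / Suc k) - ?D * (0 ^ Suc k / Suc k))) {0..1}"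
    by (rule fundamental_theorem_of_calculus)
      (auto intro!: derivative_eq_intros simp flip: has_real_derivative_iff_has_vector_derivative
        simp del: power_Suc)
  then have I: "((\<lambda>s. ?D * s ^ k) has_integral (?D / Suc k)) {0..1}" by simp
  have cont: "continuous_on (X \<times> T) (\<lambda>(x, t). G x t (neumann_term G c k x t))"
    using G continuous_on_neumann_term[OF X G c, of k]
    unfolding case_prod_unfold by (intro continuous_intros)
  have "norm (integral {0..1} ?v) \<le> integral {0..1} (\<lambda>s. ?D * s ^ k)"
  proof (rule integral_norm_bound_integral)
    show "?v integrable_on {0..1}"
      using continuous_on_along_ray[OF X cont Suc.prems] by (rule integrable_continuous_real)
    show "(\<lambda>s. ?D * s ^ k) integrable_on {0..1}" using I by blast
    fix s :: real assume s: "s \<in> {0..1}"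
    then have sx: "s * x \<in> X" using X Suc.prems by (auto intro: convex_zero_scale)
    have "norm (?v s) \<le> norm (G (s * x) t) * norm (neumann_term G c k (s * x) t)"
      by (rule norm_blinfun)
    also have "\<dots> \<le> K * (C * ((K * \<bar>s * x\<bar>) ^ k / fact k))"
      using K0 by (intro mult_mono K Suc.IH sx Suc.prems) auto
    also have "\<dots> = ?D * s ^ k"
      using s by (simp add: abs_mult power_mult_distrib)
    finally show "norm (?v s) \<le> ?D * s ^ k" .
  qed
  then have "norm (integral {0..1} ?v) \<le> ?D / Suc k"
    by (simp only: integral_unique[OF I])
  then have "\<bar>x\<bar> * norm (integral {0..1} ?v) \<le> \<bar>x\<bar> * (?D / Suc k)"
    by (rule mult_left_mono) simp
  then show ?case by (simp add: field_simps)
qed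

text \<open>The compact box contains \<open>x = 0\<close>, so that the rays along which the terms are integrated stay in
  it, and has \<open>(x0, t0)\<close> in its interior, so that uniform convergence on it settles continuity
  there.\<close>

lemma neumann_terms_locally_bounded:
  fixes G :: "real \<Rightarrow> real \<Rightarrow> 'a::banach \<Rightarrow>\<^sub>L 'a"
  assumes X: "open X" "convex X" "0 \<in> X" and T: "open T" "convex T"
    and G: "continuous_on (X \<times> T) (\<lambda>(x, t). G x t)" and c: "continuous_on T c"
    and x0: "x0 \<in> X" and t0: "t0 \<in> T"
  obtains l r l' r' K C M where "l < 0" "0 < r" "l < x0" "x0 < r" "l' < t0" "t0 < r'"
    "{l..r} \<times> {l'..r'} \<subseteq> X \<times> T" "K \<ge> 0" "C \<ge> 0"
    "\<And>x t. x \<in> {l..r} \<Longrightarrow> t \<in> {l'..r'} \<Longrightarrow> norm (G x t) \<le> K"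
    "\<And>k x t. x \<in> {l..r} \<Longrightarrow> t \<in> {l'..r'} \<Longrightarrow>
      norm (neumann_term G c k x t) \<le> C * (M ^ k / fact k)"
proof -
  obtain l r where lr: "l < 0" "l < x0" "0 < r" "x0 < r" "{l..r} \<subseteq> X"
    using compact_subinterval_with_points_inside[OF X(1,2,3) x0] .
  obtain l' r' where lr': "l' < t0" "t0 < r'" "{l'..r'} \<subseteq> T"
    using compact_subinterval_with_points_inside[OF T t0 t0] .
  have sub: "{l..r} \<times> {l'..r'} \<subseteq> X \<times> T" using lr lr' by auto
  obtain K where K: "\<And>x t. x \<in> {l..r} \<Longrightarrow> t \<in> {l'..r'} \<Longrightarrow> norm (G x t) \<le> K" "K > 0"
    using continuous_on_compact_norm_bound[OF continuous_on_subset[OF G sub]]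
    by (force simp: compact_Times)
  obtain C where C: "\<And>t. t \<in> {l'..r'} \<Longrightarrow> norm (c t) \<le> C" "C > 0"
    using continuous_on_compact_norm_bound[OF continuous_on_subset[OF c lr'(3)]] by blast
  have bnd: "norm (neumann_term G c k x t) \<le> C * ((K * max \<bar>l\<bar> \<bar>r\<bar>) ^ k / fact k)"
    if xt: "x \<in> {l..r}" "t \<in> {l'..r'}" for k x t
  proof -
    have "norm (neumann_term G c k x t) \<le> C * ((K * \<bar>x\<bar>) ^ k / fact k)"
      by (rule norm_neumann_term_le[where X = "{l..r}" and T = "{l'..r'}"])
        (use lr K C xt continuous_on_subset[OF G sub] continuous_on_subset[OF c lr'(3)] in auto)
    also have "\<dots> \<le> C * ((K * max \<bar>l\<bar> \<bar>r\<bar>) ^ k / fact k)"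
      using xt C(2) K(2) by (intro mult_left_mono divide_right_mono power_mono) auto
    finally show ?thesis .
  qed
  show ?thesis
    by (rule that[of l r l' r' K C "K * max \<bar>l\<bar> \<bar>r\<bar>"])
      (fact lr lr' sub K bnd less_imp_le[OF K(2)] less_imp_le[OF C(2)])+
qed

text \<open>The Neumann series is dominated by an exponential series on compact boxes. Its sum is therefore
  jointly continuous in \<open>x\<close> and \<open>t\<close>, and termwise integration gives the integral equation
  (\<open>int_eq\<close>), whose derivative in \<open>x\<close> is the differential equation.\<close>

lemma linear_ode_with_parameter:
  fixes G :: "real \<Rightarrow> real \<Rightarrow> 'a::euclidean_space \<Rightarrow>\<^sub>L 'a"
  assumes X: "open X" "convex X" "0 \<in> X" and T: "open T" "convex T"
    and G: "continuous_on (X \<times> T) (\<lambda>(x, t). G x t)" and c: "continuous_on T c"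
  obtains u where "continuous_on (X \<times> T) (\<lambda>(x, t). u x t)" "\<And>t. t \<in> T \<Longrightarrow> u 0 t = c t"
    "\<And>x t. x \<in> X \<Longrightarrow> t \<in> T \<Longrightarrow> has_dx u (G x t (u x t)) x t"
proof -
  let ?v = "neumann_term G c"
  define u where "u x t = (\<Sum>k. ?v k x t)" for x t
  have summable: "summable (\<lambda>k. C * (M ^ k / fact k))" for C M :: real
    using summable_exp[of M] by (intro summable_mult) (simp add: field_simps)
  have u_cont: "continuous_on (X \<times> T) (\<lambda>(x, t). u x t)"
  proof (rule continuous_at_imp_continuous_on, clarify)
    fix x0 t0 assume xt0: "x0 \<in> X" "t0 \<in> T"
    from neumann_terms_locally_bounded[OF X T G c xt0] obtain l r l' r' K C M where
      *: "l < x0" "x0 < r" "l' < t0" "t0 < r'" "{l..r} \<times> {l'..r'} \<subseteq> X \<times> T"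
      and v: "\<And>k x t. x \<in> {l..r} \<Longrightarrow> t \<in> {l'..r'} \<Longrightarrow>
        norm (?v k x t) \<le> C * (M ^ k / fact k)"
      by metis
    let ?B = "{l..r} \<times> {l'..r'}"
    have "uniform_limit ?B (\<lambda>n z. \<Sum>k<n. (\<lambda>(x, t). ?v k x t) z)
        (\<lambda>z. \<Sum>k. (\<lambda>(x, t). ?v k x t) z) sequentially"
      by (rule Weierstrass_m_test[OF _ summable[of C M]]) (use v in auto)
    then have "continuous_on ?B (\<lambda>z. \<Sum>k. (\<lambda>(x, t). ?v k x t) z)"
      by (rule uniform_limit_theorem[rotated])
        (auto intro!: always_eventually continuous_on_sum
          continuous_on_subset[OF continuous_on_neumann_term[OF X(2,3) G c] *(5)])
    then have "continuous_on ?B (\<lambda>(x, t). u x t)"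
      by (simp add: u_def case_prod_unfold)
    then have "continuous_on ({l<..<r} \<times> {l'<..<r'}) (\<lambda>(x, t). u x t)"
      by (rule continuous_on_subset) auto
    then show "isCont (\<lambda>(x, t). u x t) (x0, t0)"
      using * by (simp add: continuous_on_eq_continuous_at open_Times)
  qed
  have Gu_cont: "continuous_on (X \<times> T) (\<lambda>(x, t). G x t (u x t))"
    using G u_cont unfolding case_prod_unfold by (intro continuous_intros)
  have int_eq: "u x t = c t + x *\<^sub>R integral {0..1} (\<lambda>s. G (s * x) t (u (s * x) t))"
    if xt: "x \<in> X" "t \<in> T" for x t
  proof -
    from neumann_terms_locally_bounded[OF X T G c xt] obtain l r l' r' K C M where
      *: "l < 0" "0 < r" "l < x" "x < r" "l' < t" "t < r'" "{l..r} \<times> {l'..r'} \<subseteq> X \<times> T" "K \<ge> 0" "C \<ge> 0"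
      and K: "\<And>x t. x \<in> {l..r} \<Longrightarrow> t \<in> {l'..r'} \<Longrightarrow> norm (G x t) \<le> K"
      and v: "\<And>k x t. x \<in> {l..r} \<Longrightarrow> t \<in> {l'..r'} \<Longrightarrow>
        norm (?v k x t) \<le> C * (M ^ k / fact k)"
      by metis
    have vt: "summable (\<lambda>k. ?v k y t)" if "y \<in> {l..r}" for y
      by (rule summable_comparison_test[OF _ summable[of C "M"]])
        (use v that * in \<open>auto\<close>)
    let ?f = "\<lambda>k s. G (s * x) t (?v k (s * x) t)"
    have sx: "s * x \<in> {l..r}" if "s \<in> {0..1}" for s
      using convex_zero_scale[of "{l..r}" x s] * that by auto
    have cont_f: "continuous_on {0..1} (?f k)" for k
    proof -
      have "continuous_on (X \<times> T) (\<lambda>(x, t). G x t (?v k x t))"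
        using G continuous_on_neumann_term[OF X(2,3) G c, of k]
        unfolding case_prod_unfold by (intro continuous_intros)
      from continuous_on_along_ray[OF X(2,3) this xt] show ?thesis .
    qed
    have lim: "uniform_limit {0..1} (\<lambda>n s. \<Sum>k<n. ?f k s) (\<lambda>s. \<Sum>k. ?f k s) sequentially"
    proof (rule Weierstrass_m_test)
      fix k and s :: real assume s: "s \<in> {0..1}"
      have "norm (?f k s) \<le> norm (G (s * x) t) * norm (?v k (s * x) t)"
        by (rule norm_blinfun)
      also have "\<dots> \<le> K * (C * (M ^ k / fact k))"
        using sx[OF s] * by (intro mult_mono K v) auto
      finally show "norm (?f k s) \<le> (K * C) * (M ^ k / fact k)" by simp
    qed (rule summable[of "K * C" M])
    have lim_eq: "(\<Sum>k. ?f k s) = G (s * x) t (u (s * x) t)" if "s \<in> {0..1}" for s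
      unfolding u_def by (rule blinfun.bounded_linear_right[THEN bounded_linear.suminf, symmetric])
        (rule vt[OF sx[OF that]])
    have "uniform_limit {0..1} (\<lambda>n s. \<Sum>k<n. ?f k s)
        (\<lambda>s. G (s * x) t (u (s * x) t)) sequentially"
      by (rule uniform_limit_cong'[THEN iffD1, OF refl lim_eq lim])
    then obtain I J where I: "\<And>n. ((\<lambda>s. \<Sum>k<n. ?f k s) has_integral I n) {0..1}"
      and J: "((\<lambda>s. G (s * x) t (u (s * x) t)) has_integral J) {0..1}"
      and IJ: "I \<longlonglongrightarrow> J"
      by (rule uniform_limit_integral) (auto intro!: continuous_on_sum cont_f)
    have In: "x *\<^sub>R I n = (\<Sum>k<n. ?v (Suc k) x t)" for n
    proof -
      have "I n = integral {0..1} (\<lambda>s. \<Sum>k<n. ?f k s)"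
        using I[of n] by (simp add: integral_unique)
      also have "\<dots> = (\<Sum>k<n. integral {0..1} (?f k))"
        by (rule integral_sum) (auto intro!: integrable_continuous_real cont_f)
      finally show ?thesis by (simp add: scaleR_sum_right)
    qed
    have "(\<lambda>n. \<Sum>k<n. ?v (Suc k) x t) \<longlonglongrightarrow> x *\<^sub>R J"
      using tendsto_scaleR[OF tendsto_const[of x] IJ] by (simp add: In)
    then have "(\<lambda>k. ?v (Suc k) x t) sums (x *\<^sub>R J)" by (simp add: sums_def)
    then have "(\<lambda>k. ?v k x t) sums (x *\<^sub>R J + ?v 0 x t)" by (rule sums_Suc)
    then have "u x t = x *\<^sub>R J + c t" by (simp add: u_def sums_iff)
    moreover have "J = integral {0..1} (\<lambda>s. G (s * x) t (u (s * x) t))"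
      using J by (simp add: integral_unique)
    ultimately show ?thesis by simp
  qed
  show ?thesis
  proof (rule that[OF u_cont])
    show "u 0 t = c t" if "t \<in> T" for t
      using int_eq[OF X(3) that] by simp
    fix x t assume xt: "x \<in> X" "t \<in> T"
    have "continuous_on X (\<lambda>y. (\<lambda>(x, t). G x t (u x t)) (y, t))"
      by (rule continuous_on_compose2[OF Gu_cont]) (use xt in \<open>auto intro!: continuous_intros\<close>)
    then have "continuous_on X (\<lambda>y. G y t (u y t))" by simp
    from has_vector_derivative_add[OF has_vector_derivative_const[of "c t"]
      scaled_integral_has_vector_derivative[OF X this xt(1)]]
    have "((\<lambda>x. c t + x *\<^sub>R integral {0..1} (\<lambda>s. G (s * x) t (u (s * x) t)))
        has_vector_derivative G x t (u x t)) (at x)"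
      by simp
    then show "has_dx u (G x t (u x t)) x t"
      by (rule has_vector_derivative_transform_within_open[where S = X])
        (use X xt int_eq in auto)
  qed
qed

section \<open>Compatible pairs of linear systems\<close>

text \<open>Gronwall's inequality, with the inhomogeneity and the initial value measured by the same \<open>e\<close>.
  It follows because \<open>(\<bar>d\<bar>\<^sup>2 + e\<^sup>2) exp (- (2 K + 1) x)\<close> does not increase.\<close>

lemma gronwall_right:
  fixes d :: "real \<Rightarrow> 'a::real_inner"
  assumes b: "0 \<le> b" and d: "\<And>x. 0 \<le> x \<Longrightarrow> x \<le> b \<Longrightarrow> (d has_vector_derivative d' x) (at x)"
    and d': "\<And>x. 0 \<le> x \<Longrightarrow> x \<le> b \<Longrightarrow> norm (d' x) \<le> K * norm (d x) + e"
    and d0: "norm (d 0) \<le> e" and K: "K \<ge> 0"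
  shows "(norm (d b))\<^sup>2 \<le> 2 * e\<^sup>2 * exp ((2 * K + 1) * b)"
proof -
  define \<phi> where "\<phi> x = (d x \<bullet> d x + e\<^sup>2) * exp (- ((2 * K + 1) * x))" for x
  have e: "e \<ge> 0" using d0 norm_ge_zero order_trans by blast
  have "\<phi> b \<le> \<phi> 0"
  proof (rule DERIV_nonpos_imp_nonincreasing[OF b])
    fix x assume x: "0 \<le> x" "x \<le> b"
    have inner: "((\<lambda>x. d x \<bullet> d x) has_real_derivative (d x \<bullet> d' x + d' x \<bullet> d x)) (at x)"
      unfolding has_real_derivative_iff_has_vector_derivative
      by (rule bounded_bilinear.has_vector_derivative[OF bounded_bilinear_inner d[OF x] d[OF x]])
    have "(\<phi> has_real_derivative ((d x \<bullet> d' x + d' x \<bullet> d x)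
        - (2 * K + 1) * (d x \<bullet> d x + e\<^sup>2)) * exp (- ((2 * K + 1) * x))) (at x)"
      unfolding \<phi>_def by (auto intro!: derivative_eq_intros inner simp: algebra_simps)
    moreover have "(d x \<bullet> d' x + d' x \<bullet> d x) - (2 * K + 1) * (d x \<bullet> d x + e\<^sup>2) \<le> 0"
    proof -
      have "d x \<bullet> d' x \<le> norm (d x) * norm (d' x)" by (rule norm_cauchy_schwarz)
      also have "\<dots> \<le> norm (d x) * (K * norm (d x) + e)"
        by (rule mult_left_mono[OF d'[OF x]]) simp
      finally have 1: "2 * (d x \<bullet> d' x) \<le> 2 * K * (norm (d x))\<^sup>2 + 2 * norm (d x) * e"
        by (simp add: power2_eq_square algebra_simps)
      have 2: "2 * norm (d x) * e \<le> (norm (d x))\<^sup>2 + e\<^sup>2"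
        by (rule sum_squares_bound)
      have "K * e\<^sup>2 \<ge> 0" using K by simp
      with 1 2 show ?thesis
        by (simp add: power2_norm_eq_inner inner_commute[of "d' x"] algebra_simps)
    qed
    ultimately show "\<exists>y. (\<phi> has_real_derivative y) (at x) \<and> y \<le> 0"
      by (meson exp_ge_zero mult_nonpos_nonneg)
  qed
  then have "(d b \<bullet> d b + e\<^sup>2) * exp (- ((2 * K + 1) * b)) \<le> d 0 \<bullet> d 0 + e\<^sup>2"
    by (simp add: \<phi>_def)
  then have "d b \<bullet> d b + e\<^sup>2 \<le> (d 0 \<bullet> d 0 + e\<^sup>2) * exp ((2 * K + 1) * b)"
    by (simp only: exp_minus divide_inverse[symmetric] pos_divide_le_eq[OF exp_gt_zero])
  also have "\<dots> \<le> (e\<^sup>2 + e\<^sup>2) * exp ((2 * K + 1) * b)"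
    using d0 e by (intro mult_right_mono add_right_mono)
      (auto simp flip: power2_norm_eq_inner intro: power_mono)
  finally show ?thesis
    using zero_le_power2[of e] unfolding power2_norm_eq_inner mult_2[symmetric] by linarith
qed

lemma gronwall:
  fixes d :: "real \<Rightarrow> 'a::real_inner"
  assumes d: "\<And>x. x \<in> closed_segment 0 b \<Longrightarrow> (d has_vector_derivative d' x) (at x)"
    and d': "\<And>x. x \<in> closed_segment 0 b \<Longrightarrow> norm (d' x) \<le> K * norm (d x) + e"
    and d0: "norm (d 0) \<le> e" and K: "K \<ge> 0"
  shows "(norm (d b))\<^sup>2 \<le> 2 * e\<^sup>2 * exp ((2 * K + 1) * \<bar>b\<bar>)"
proof (cases "0 \<le> b")
  case True
  then show ?thesis
    using gronwall_right[of b d d' K e] d d' d0 K by (simp add: closed_segment_eq_real_ivl)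
next
  case False
  then have seg: "- x \<in> closed_segment 0 b" if "0 \<le> x" "x \<le> - b" for x
    using that by (simp add: closed_segment_eq_real_ivl)
  have "(norm (d (- (- b))))\<^sup>2 \<le> 2 * e\<^sup>2 * exp ((2 * K + 1) * (- b))"
  proof (rule gronwall_right[of "- b" "\<lambda>x. d (- x)" "\<lambda>x. - d' (- x)" K e])
    fix x assume x: "0 \<le> x" "x \<le> - b"
    have "(d \<circ> uminus has_vector_derivative (- 1) *\<^sub>R d' (- x)) (at x)"
      by (rule vector_diff_chain_at) (auto intro!: derivative_eq_intros d seg x)
    then show "((\<lambda>x. d (- x)) has_vector_derivative - d' (- x)) (at x)"
      by (simp add: o_def)
  qed (use False d' d0 K seg in auto)
  with False show ?thesis by simp
qed

lemma linear_ode_unique: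
  fixes G :: "real \<Rightarrow> 'a::euclidean_space \<Rightarrow>\<^sub>L 'a"
  assumes X: "convex X" "0 \<in> X" and G: "continuous_on X G"
    and u: "\<And>x. x \<in> X \<Longrightarrow> (u has_vector_derivative G x (u x)) (at x)"
    and v: "\<And>x. x \<in> X \<Longrightarrow> (v has_vector_derivative G x (v x)) (at x)"
    and 0: "u 0 = v 0" and x: "x \<in> X"
  shows "u x = v x"
proof -
  have seg: "closed_segment 0 x \<subseteq> X" using X x by (simp add: closed_segment_subset)
  obtain K where K: "K > 0" "\<And>y. y \<in> closed_segment 0 x \<Longrightarrow> norm (G y) \<le> K"
    using continuous_on_compact_norm_bound[OF continuous_on_subset[OF G seg] compact_segment] by blast
  have "(norm (u x - v x))\<^sup>2 \<le> 2 * 0\<^sup>2 * exp ((2 * K + 1) * \<bar>x\<bar>)"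
  proof (rule gronwall[where d' = "\<lambda>y. G y (u y - v y)"])
    fix y assume y: "y \<in> closed_segment 0 x"
    show "((\<lambda>y. u y - v y) has_vector_derivative G y (u y - v y)) (at y)"
      using u v y seg by (auto intro!: derivative_eq_intros simp: blinfun.diff_right)
    show "norm (G y (u y - v y)) \<le> K * norm (u y - v y) + 0"
      using norm_blinfun[of "G y" "u y - v y"] mult_right_mono[OF K(2)[OF y] norm_ge_zero[of "u y - v y"]]
      by linarith
  qed (use 0 K in auto)
  then show ?thesis by simp
qed

text \<open>Two solutions agree first along the \<open>t\<close>-axis, and from there along every line \<open>t = const\<close>.\<close>

lemma frobenius_unique:
  fixes G F :: "real \<Rightarrow> real \<Rightarrow> 'a::euclidean_space \<Rightarrow>\<^sub>L 'a"
  assumes X: "convex X" "0 \<in> X" and T: "convex T" "0 \<in> T"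
    and G: "continuous_on (X \<times> T) (\<lambda>(x, t). G x t)" and F: "continuous_on (X \<times> T) (\<lambda>(x, t). F x t)"
    and u: "\<And>x t. x \<in> X \<Longrightarrow> t \<in> T \<Longrightarrow> has_dx u (G x t (u x t)) x t \<and> has_dt u (F x t (u x t)) x t"
    and v: "\<And>x t. x \<in> X \<Longrightarrow> t \<in> T \<Longrightarrow> has_dx v (G x t (v x t)) x t \<and> has_dt v (F x t (v x t)) x t"
    and 0: "u 0 0 = v 0 0" and xt: "x \<in> X" "t \<in> T"
  shows "u x t = v x t"
proof -
  have "continuous_on T (\<lambda>t. (\<lambda>(x, t). F x t) (0, t))"
    by (rule continuous_on_compose2[OF F]) (use X in \<open>auto intro!: continuous_intros\<close>)
  then have F0: "continuous_on T (\<lambda>t. F 0 t)" by simp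
  have "continuous_on X (\<lambda>x. (\<lambda>(x, t). G x t) (x, t))"
    by (rule continuous_on_compose2[OF G]) (use xt in \<open>auto intro!: continuous_intros\<close>)
  then have Gt: "continuous_on X (\<lambda>x. G x t)" by simp
  have "u 0 t = v 0 t"
    by (rule linear_ode_unique[OF T F0, where u = "\<lambda>t. u 0 t" and v = "\<lambda>t. v 0 t"])
      (simp_all add: u v X(2) 0 xt(2))
  show ?thesis
    by (rule linear_ode_unique[OF X Gt, where u = "\<lambda>x. u x t" and v = "\<lambda>x. v x t"])
      (simp_all add: u v xt \<open>u 0 t = v 0 t\<close>)
qed

text \<open>If \<open>u\<^sub>x = G u\<close> then, by the compatibility condition, \<open>F u\<close> satisfies the equation that one
  obtains from \<open>u\<^sub>x = G u\<close> by formal differentiation in \<open>t\<close>. So does, up to a small error, the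
  difference quotient of \<open>u\<close> in \<open>t\<close>, and Gronwall's inequality carries their closeness from \<open>x = 0\<close>
  to all \<open>x\<close>.\<close>

lemma has_dt_from_compatibility:
  fixes G F G' F' :: "real \<Rightarrow> real \<Rightarrow> 'a::euclidean_space \<Rightarrow>\<^sub>L 'a"
  assumes X: "convex X" "0 \<in> X" and T: "open T"
    and G: "continuous_on (X \<times> T) (\<lambda>(x, t). G x t)"
    and G': "continuous_on (X \<times> T) (\<lambda>(x, t). G' x t)"
    and dG: "\<And>x t. x \<in> X \<Longrightarrow> t \<in> T \<Longrightarrow> has_dt G (G' x t) x t"
    and dF: "\<And>x t. x \<in> X \<Longrightarrow> t \<in> T \<Longrightarrow> has_dx F (F' x t) x t"
    and compat: "\<And>x t. x \<in> X \<Longrightarrow> t \<in> T \<Longrightarrow> G' x t + (G x t o\<^sub>L F x t) = F' x t + (F x t o\<^sub>L G x t)"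
    and u: "continuous_on (X \<times> T) (\<lambda>(x, t). u x t)"
    and ux: "\<And>x t. x \<in> X \<Longrightarrow> t \<in> T \<Longrightarrow> has_dx u (G x t (u x t)) x t"
    and ut0: "\<And>t. t \<in> T \<Longrightarrow> has_dt u (F 0 t (u 0 t)) 0 t"
    and x1: "x1 \<in> X" and t1: "t1 \<in> T"
  shows "has_dt u (F x1 t1 (u x1 t1)) x1 t1"
  unfolding has_vector_derivative_iff_quotient
proof (rule tendstoI)
  fix \<epsilon> :: real assume \<epsilon>: "\<epsilon> > 0"
  define I where "I = closed_segment 0 x1"
  have I: "I \<subseteq> X" "0 \<in> I" "x1 \<in> I" "compact I"
    using X x1 by (auto simp: I_def closed_segment_subset)
  obtain \<eta> where \<eta>: "\<eta> > 0" "cball t1 \<eta> \<subseteq> T"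
    using T t1 by (meson open_contains_cball)
  define J where "J = cball t1 \<eta>"
  have J: "J \<subseteq> T" "compact J" "convex J" "t1 \<in> J" using \<eta> by (auto simp: J_def)
  have IJ: "I \<times> J \<subseteq> X \<times> T" "compact (I \<times> J)" using I J by (auto intro: compact_Times)
  obtain K where K: "K > 0" "\<And>z. z \<in> I \<times> J \<Longrightarrow> norm (case z of (x, t) \<Rightarrow> G x t) \<le> K"
    using continuous_on_compact_norm_bound[OF continuous_on_subset[OF G IJ(1)] IJ(2)] by blast
  obtain W where W: "W > 0" "\<And>z. z \<in> I \<times> J \<Longrightarrow> norm (case z of (x, t) \<Rightarrow> u x t) \<le> W"
    using continuous_on_compact_norm_bound[OF continuous_on_subset[OF u IJ(1)] IJ(2)] by blast
  obtain M where M: "M > 0" "\<And>z. z \<in> I \<times> J \<Longrightarrow> norm (case z of (x, t) \<Rightarrow> G' x t) \<le> M"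
    using continuous_on_compact_norm_bound[OF continuous_on_subset[OF G' IJ(1)] IJ(2)] by blast
  \<comment> \<open>\<open>C\<close> is the constant of Gronwall's inequality at \<open>x1\<close>; \<open>e2\<close> has to bound both the initial value and
    the error term \<open>\<rho>\<close> below, and \<open>e1\<close> is the accuracy in \<open>G'\<close> and \<open>u\<close> that achieves this for \<open>\<rho>\<close>.\<close>
  define C where "C = sqrt (2 * exp ((2 * K + 1) * \<bar>x1\<bar>))"
  have C: "C > 0" by (simp add: C_def)
  define e2 where "e2 = \<epsilon> / (2 * C)"
  have e2: "e2 > 0" using \<epsilon> C by (simp add: e2_def)
  define e1 where "e1 = e2 / (W + M)"
  have "e1 > 0" "e1 * (W + M) = e2" using e2 W(1) M(1) by (simp_all add: e1_def)
  then have e1: "e1 > 0" "e1 * W + M * e1 = e2" by (simp_all add: algebra_simps)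
  have "uniformly_continuous_on (I \<times> J) (\<lambda>(x, t). u x t)"
    by (rule compact_uniformly_continuous[OF continuous_on_subset[OF u IJ(1)] IJ(2)])
  then obtain r where r: "r > 0" "\<And>z z'. z \<in> I \<times> J \<Longrightarrow> z' \<in> I \<times> J \<Longrightarrow> dist z' z < r \<Longrightarrow>
      dist (case z' of (x, t) \<Rightarrow> u x t) (case z of (x, t) \<Rightarrow> u x t) < e1"
    unfolding uniformly_continuous_on_def using e1(1) by metis
  have "uniformly_continuous_on (I \<times> J) (\<lambda>(x, t). G' x t)"
    by (rule compact_uniformly_continuous[OF continuous_on_subset[OF G' IJ(1)] IJ(2)])
  then obtain r' where r': "r' > 0" "\<And>z z'. z \<in> I \<times> J \<Longrightarrow> z' \<in> I \<times> J \<Longrightarrow> dist z' z < r' \<Longrightarrow>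
      dist (case z' of (x, t) \<Rightarrow> G' x t) (case z of (x, t) \<Rightarrow> G' x t) < e1"
    unfolding uniformly_continuous_on_def using e1(1) by metis
  have "\<forall>\<^sub>F t in at t1. dist ((1 / (t - t1)) *\<^sub>R (u 0 t - u 0 t1)) (F 0 t1 (u 0 t1)) < e2"
    using ut0[OF t1] e2 unfolding has_vector_derivative_iff_quotient by (rule tendstoD)
  moreover have "\<forall>\<^sub>F t in at t1. dist t t1 < min \<eta> (min r r')"
    unfolding eventually_at by (rule exI[of _ "min \<eta> (min r r')"]) (use \<eta>(1) r(1) r'(1) in simp)
  moreover have "\<forall>\<^sub>F t in at t1. t \<noteq> t1"
    by (rule eventually_neq_at_within)
  ultimately show "\<forall>\<^sub>F t in at t1. dist ((1 / (t - t1)) *\<^sub>R (u x1 t - u x1 t1)) (F x1 t1 (u x1 t1)) < \<epsilon>"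
  proof eventually_elim
    case (elim t)
    define h where "h = t - t1"
    have h: "h \<noteq> 0" using elim by (simp add: h_def)
    have t: "t \<in> J" using elim by (simp add: J_def dist_commute)
    have Gdiff: "norm ((1 / h) *\<^sub>R (G x t - G x t1) - G' x t1) \<le> e1" if x: "x \<in> I" for x
    proof -
      have seg: "closed_segment t1 t \<subseteq> J" using J t by (simp add: closed_segment_subset)
      have "norm (G x t - G x t1 - (t - t1) *\<^sub>R G' x t1) \<le> norm (t - t1) * e1"
      proof (rule vector_differentiable_bound_linearization[where S = "closed_segment t1 t" and f' = "G' x"])
        fix s assume s: "s \<in> closed_segment t1 t"
        show "(G x has_vector_derivative G' x s) (at s within closed_segment t1 t)"
          using dG[of x s] x s I(1) J(1) seg by (auto intro: has_vector_derivative_at_within)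
        have "dist (x, s) (x, t1) < r'"
          using elim dist_in_closed_segment[OF s] by (simp add: dist_Pair_Pair dist_commute)
        then show "norm (G' x s - G' x t1) \<le> e1"
          using r'(2)[of "(x, t1)" "(x, s)"] x s seg J(4) by (auto simp: dist_norm)
      qed auto
      also have "G x t - G x t1 - (t - t1) *\<^sub>R G' x t1 = h *\<^sub>R ((1 / h) *\<^sub>R (G x t - G x t1) - G' x t1)"
        using h by (simp add: scaleR_diff_right h_def)
      finally show ?thesis using h by (simp add: h_def)
    qed
    \<comment> \<open>The difference quotient minus the expected derivative; it satisfies \<open>\<delta>\<^sub>x = G \<delta> + \<rho>\<close>.\<close>
    define \<delta> where "\<delta> x = (1 / h) *\<^sub>R (u x t - u x t1) - F x t1 (u x t1)" for x
    define \<rho> where "\<rho> x = ((1 / h) *\<^sub>R (G x t - G x t1) - G' x t1) (u x t) + G' x t1 (u x t - u x t1)" for x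
    have "(norm (\<delta> x1))\<^sup>2 \<le> 2 * e2\<^sup>2 * exp ((2 * K + 1) * \<bar>x1\<bar>)"
    proof (rule gronwall[where d' = "\<lambda>x. G x t1 (\<delta> x) + \<rho> x"])
      fix x assume "x \<in> closed_segment 0 x1"
      then have x: "x \<in> I" "x \<in> X" using I by (auto simp: I_def)
      have tT: "t \<in> T" using t J by auto
      have "(\<delta> has_vector_derivative ((1 / h) *\<^sub>R (G x t (u x t) - G x t1 (u x t1))
          - (F x t1 (G x t1 (u x t1)) + F' x t1 (u x t1)))) (at x)"
        unfolding \<delta>_def
        by (intro derivative_intros ux x tT t1 dF
            bounded_linear.has_vector_derivative[OF bounded_linear_scaleR_right]
            bounded_bilinear.has_vector_derivative[OF bounded_bilinear_blinfun_apply])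
      moreover have "F x t1 (G x t1 (u x t1)) + F' x t1 (u x t1)
          = G' x t1 (u x t1) + G x t1 (F x t1 (u x t1))"
        using arg_cong[OF compat[OF x(2) t1], of "\<lambda>L. L (u x t1)"] by (simp add: blinfun.add_left)
      moreover have "(1 / h) *\<^sub>R (G x t (u x t) - G x t1 (u x t1))
          - (G' x t1 (u x t1) + G x t1 (F x t1 (u x t1))) = G x t1 (\<delta> x) + \<rho> x"
        by (simp add: \<delta>_def \<rho>_def blinfun.bilinear_simps algebra_simps)
      ultimately show "(\<delta> has_vector_derivative G x t1 (\<delta> x) + \<rho> x) (at x)"
        by simp
      have "norm (\<rho> x) \<le> norm ((1 / h) *\<^sub>R (G x t - G x t1) - G' x t1) * norm (u x t)
          + norm (G' x t1) * norm (u x t - u x t1)"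
        unfolding \<rho>_def by (intro norm_triangle_mono norm_blinfun)
      also have "\<dots> \<le> e1 * W + M * e1"
      proof (intro add_mono mult_mono)
        show "norm (u x t) \<le> W" using W(2)[of "(x, t)"] x t by simp
        show "norm (G' x t1) \<le> M" using M(2)[of "(x, t1)"] x J by simp
        show "norm (u x t - u x t1) \<le> e1"
          using r(2)[of "(x, t1)" "(x, t)"] x t J(4) elim by (simp add: dist_Pair_Pair dist_norm)
      qed (use Gdiff x e1 M in auto)
      finally have "norm (\<rho> x) \<le> e2" using e1(2) by simp
      moreover have "norm (G x t1 (\<delta> x)) \<le> K * norm (\<delta> x)"
      proof -
        have "norm (G x t1) \<le> K" using K(2)[of "(x, t1)"] x J by simp
        then have "norm (G x t1) * norm (\<delta> x) \<le> K * norm (\<delta> x)" by (rule mult_right_mono) simp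
        with norm_blinfun[of "G x t1" "\<delta> x"] show ?thesis by linarith
      qed
      ultimately show "norm (G x t1 (\<delta> x) + \<rho> x) \<le> K * norm (\<delta> x) + e2"
        by (rule norm_triangle_mono[rotated])
    next
      show "norm (\<delta> 0) \<le> e2" using elim(1) by (simp add: \<delta>_def h_def dist_norm)
      show "0 \<le> K" using K(1) by simp
    qed
    also have "\<dots> = (e2 * C)\<^sup>2"
      by (simp add: C_def power_mult_distrib)
    finally have "norm (\<delta> x1) \<le> e2 * C"
      using e2 C by (simp add: power2_le_iff_abs_le)
    also have "\<dots> < \<epsilon>" using \<epsilon> C by (simp add: e2_def)
    finally show ?case by (simp add: \<delta>_def h_def dist_norm)
  qed
qed

text \<open>The compatibility condition is the equality of the mixed derivatives \<open>(G u)\<^sub>t\<close> and \<open>(F u)\<^sub>x\<close>.\<close>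

theorem frobenius_linear:
  fixes G F G' F' :: "real \<Rightarrow> real \<Rightarrow> 'a::euclidean_space \<Rightarrow>\<^sub>L 'a"
  assumes X: "open X" "convex X" "0 \<in> X" and T: "open T" "convex T" "0 \<in> T"
    and G: "continuous_on (X \<times> T) (\<lambda>(x, t). G x t)" and F: "continuous_on (X \<times> T) (\<lambda>(x, t). F x t)"
    and G': "continuous_on (X \<times> T) (\<lambda>(x, t). G' x t)"
    and dG: "\<And>x t. x \<in> X \<Longrightarrow> t \<in> T \<Longrightarrow> has_dt G (G' x t) x t"
    and dF: "\<And>x t. x \<in> X \<Longrightarrow> t \<in> T \<Longrightarrow> has_dx F (F' x t) x t"
    and compat: "\<And>x t. x \<in> X \<Longrightarrow> t \<in> T \<Longrightarrow> G' x t + (G x t o\<^sub>L F x t) = F' x t + (F x t o\<^sub>L G x t)"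
  shows "\<exists>u. continuous_on (X \<times> T) (\<lambda>(x, t). u x t) \<and> u 0 0 = u0 \<and>
    (\<forall>x\<in>X. \<forall>t\<in>T. has_dx u (G x t (u x t)) x t \<and> has_dt u (F x t (u x t)) x t)"
proof -
  have "continuous_on (T \<times> UNIV) (\<lambda>z. (\<lambda>(x, t). F x t) (0, fst z))"
    by (rule continuous_on_compose2[OF F]) (use X in \<open>auto intro!: continuous_intros\<close>)
  then have F0: "continuous_on (T \<times> (UNIV :: real set)) (\<lambda>(t, s). F 0 t)"
    by (simp add: case_prod_unfold)
  obtain w where w: "\<And>s. w 0 s = u0" "\<And>t s. t \<in> T \<Longrightarrow> has_dx w (F 0 t (w t s)) t s"
    using linear_ode_with_parameter[OF T open_UNIV convex_UNIV F0 continuous_on_const[of _ u0]]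
    by (metis UNIV_I)
  define c where "c t = w t 0" for t
  have c: "(c has_vector_derivative F 0 t (c t)) (at t)" if "t \<in> T" for t
    using w(2)[OF that, of 0] by (simp add: c_def[abs_def])
  have c_cont: "continuous_on T c"
    using c by (meson continuous_at_imp_continuous_on has_vector_derivative_continuous)
  obtain u where u: "continuous_on (X \<times> T) (\<lambda>(x, t). u x t)" "\<And>t. t \<in> T \<Longrightarrow> u 0 t = c t"
    "\<And>x t. x \<in> X \<Longrightarrow> t \<in> T \<Longrightarrow> has_dx u (G x t (u x t)) x t"
    using linear_ode_with_parameter[OF X T(1,2) G c_cont] by metis
  have ut0: "has_dt u (F 0 t (u 0 t)) 0 t" if "t \<in> T" for t
    using has_vector_derivative_transform_within_open[OF c[OF that] T(1) that, of "u 0"] u(2) that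
    by simp
  show ?thesis
  proof (intro exI[of _ u] conjI ballI u(1))
    show "u 0 0 = u0" using u(2)[OF T(3)] by (simp add: c_def w)
    fix x t assume xt: "x \<in> X" "t \<in> T"
    show "has_dt u (F x t (u x t)) x t"
      by (rule has_dt_from_compatibility[where X = X and T = T and G = G and G' = G' and F = F
            and F' = F' and u = u])
        (fact X T G G' dG dF compat u ut0 xt)+
    show "has_dx u (G x t (u x t)) x t" by (rule u(3)[OF xt])
  qed
qed

section \<open>Transfer matrix functions of S-nodes\<close>

text \<open>In the application \<open>C = A\<^sup>*\<close>, or \<open>A - \<lambda>\<close> and \<open>A\<^sup>* + \<lambda>\<close> take the roles of \<open>A\<close> and \<open>C\<close>: shifting the pair
  by \<open>\<lambda>\<close> preserves the node identity, so that \<open>I - X\<close> of the shifted node is the transfer function at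
  \<open>\<lambda>\<close> of the original one.\<close>

locale s_node =
  fixes A C S :: "complex ^ 'n ^ 'n" and P :: "complex ^ 'm ^ 'n" and N :: "complex ^ 'n ^ 'm"
  assumes inv_A: "invertible A" and inv_C: "invertible C" and inv_S: "invertible S"
    and node: "A ** S + S ** C = \<i> *\<^sub>m (P ** N)"
begin

abbreviation "Ai \<equiv> matrix_inv A"
abbreviation "Ci \<equiv> matrix_inv C"
abbreviation "Z \<equiv> matrix_inv S"

definition "B = N ** Z"
definition "X0 = \<i> *\<^sub>m (B ** P)"
definition "X = \<i> *\<^sub>m (B ** Ai ** P)"
definition "Y = (- \<i>) *\<^sub>m (N ** Ci ** Z ** P)"

lemmas inverse_rules = matrix_inv_left[OF inv_A] matrix_inv_right[OF inv_A]
  matrix_inv_left[OF inv_C] matrix_inv_right[OF inv_C]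
  matrix_inv_left[OF inv_S] matrix_inv_right[OF inv_S]

lemmas inverse_simps = inverse_rules inverse_rules[THEN mult_eq_extend]

text \<open>The node identity multiplied by \<open>S\<inverse>\<close> from both sides trades \<open>C\<close>, which acts on the side of \<open>N\<close>, for
  \<open>A\<close>; multiplied in addition by \<open>A\<inverse>\<close> and \<open>C\<inverse>\<close> it does the same for the inverses.\<close>

lemma C_Z: "C ** Z = \<i> *\<^sub>m (Z ** P ** B) - Z ** A"
proof -
  have "Z ** (A ** S + S ** C) ** Z = Z ** (\<i> *\<^sub>m (P ** N)) ** Z" by (simp add: node)
  then show ?thesis by (simp add: mat_expand inverse_simps B_def eq_diff_eq add.commute)
qed

lemma Ci_Z: "Ci ** Z = \<i> *\<^sub>m (Z ** Ai ** P ** N ** Ci ** Z) - Z ** Ai"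
proof -
  have "Z ** Ai ** (A ** S + S ** C) ** Ci ** Z = Z ** Ai ** (\<i> *\<^sub>m (P ** N)) ** Ci ** Z"
    by (simp add: node)
  then show ?thesis by (simp add: mat_expand inverse_simps eq_diff_eq)
qed

lemma one_minus_X_mult: "(mat 1 - X) ** (N ** Ci ** Z) = - (B ** Ai)"
proof -
  have "N ** (Ci ** Z) = \<i> *\<^sub>m (N ** Z ** Ai ** P ** N ** Ci ** Z) - N ** Z ** Ai"
    by (subst Ci_Z) (simp add: mat_expand)
  then have "N ** (Ci ** Z) - \<i> *\<^sub>m (N ** Z ** Ai ** P ** N ** Ci ** Z) = - (N ** Z ** Ai)"
    by simp
  then show ?thesis by (simp add: X_def B_def mat_expand)
qed

lemma transfer_inverse:
  "(mat 1 - X) ** (mat 1 + Y) = mat 1" "(mat 1 + Y) ** (mat 1 - X) = mat 1"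
proof -
  have "(mat 1 - X) ** Y = (- \<i>) *\<^sub>m ((mat 1 - X) ** (N ** Ci ** Z) ** P)"
    by (simp add: Y_def mat_expand)
  also have "\<dots> = X"
    unfolding one_minus_X_mult by (simp add: X_def mat_expand)
  finally show 1: "(mat 1 - X) ** (mat 1 + Y) = mat 1"
    by (simp add: matrix_add_ldistrib)
  then show "(mat 1 + Y) ** (mat 1 - X) = mat 1"
    by (simp add: matrix_left_right_inverse)
qed

lemma invertible_transfer: "invertible (mat 1 - X)"
  and matrix_inv_transfer: "matrix_inv (mat 1 - X) = mat 1 + Y"
  using transfer_inverse by (auto simp: invertible_def intro: matrix_inv_unique)

lemma N_Ci_Z: "N ** Ci ** Z = - ((mat 1 + Y) ** B ** Ai)"
proof -
  have "(mat 1 + Y) ** ((mat 1 - X) ** (N ** Ci ** Z)) = (mat 1 + Y) ** (- (B ** Ai))"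
    by (simp add: one_minus_X_mult)
  then show ?thesis by (simp add: matrix_mul_assoc transfer_inverse matrix_mult_uminus_right)
qed

text \<open>The coefficients that the transfer function intertwines with \<open>Q\<close> and with \<open>c0\<close>.\<close>

definition "Q_dressed Q = (mat 1 - X) ** Q ** (mat 1 + Y)"

definition "q_dressed c0 c1 = c0 - (c1 ** X0 - X0 ** c1)"

lemma Q_dressed_X: "Q_dressed Q ** X = Q_dressed Q - Q + X ** Q"
proof -
  have "Q_dressed Q ** (mat 1 - X) = (mat 1 - X) ** Q"
    by (simp add: Q_dressed_def matrix_mul_assoc[symmetric] transfer_inverse)
  then show ?thesis by (simp add: mat_expand algebra_simps)
qed

text \<open>In the next lemmas the left-hand sides are what the product rule gives for the derivatives of
  \<open>B = N S\<inverse>\<close>, of \<open>X0\<close> and of the transfer function \<open>I - \<i> B (A - l)\<inverse> P\<close>, when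
  \<open>P\<^sub>x = P c0 + A P c1\<close>, \<open>N\<^sub>x = - c0 N + c1 N C\<close>, \<open>S\<^sub>x = \<i> P c1 N\<close> and
  \<open>P\<^sub>t = A\<inverse> P Q\<close>, \<open>N\<^sub>t = Q N C\<inverse>\<close>, \<open>S\<^sub>t = \<i> A\<inverse> P Q N C\<inverse>\<close>. So \<open>B\<close> solves the systems dual to those of \<open>P\<close>,
  with dressed coefficients.\<close>

lemma B_x:
  "(- (c0 ** N) + c1 ** N ** C) ** Z - N ** Z ** (\<i> *\<^sub>m (P ** c1 ** N)) ** Z
    = - (q_dressed c0 c1 ** B + c1 ** B ** A)"
proof -
  have "(- (c0 ** N) + c1 ** N ** C) ** Z = - (c0 ** B) + c1 ** N ** (C ** Z)"
    by (simp add: B_def mat_expand)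
  also have "c1 ** N ** (C ** Z) = c1 ** X0 ** B - c1 ** B ** A"
    unfolding C_Z by (simp add: B_def X0_def mat_expand)
  finally show ?thesis
    by (simp add: q_dressed_def X0_def B_def mat_expand algebra_simps)
qed

lemma B_t:
  "Q ** N ** Ci ** Z - N ** Z ** (\<i> *\<^sub>m (Ai ** P ** Q ** N ** Ci)) ** Z = - (Q_dressed Q ** B ** Ai)"
proof -
  have "Q ** N ** Ci ** Z - N ** Z ** (\<i> *\<^sub>m (Ai ** P ** Q ** N ** Ci)) ** Z
      = (mat 1 - X) ** Q ** (N ** Ci ** Z)"
    by (simp add: X_def B_def mat_expand)
  then show ?thesis unfolding N_Ci_Z by (simp add: Q_dressed_def mat_expand)
qed

lemma X0_t: "\<i> *\<^sub>m (B ** (Ai ** P ** Q) + - (Q_dressed Q ** B ** Ai) ** P) = Q - Q_dressed Q"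
proof -
  have "\<i> *\<^sub>m (B ** (Ai ** P ** Q) + - (Q_dressed Q ** B ** Ai) ** P) = X ** Q - Q_dressed Q ** X"
    by (simp add: X_def mat_expand)
  then show ?thesis by (simp add: Q_dressed_X)
qed

lemma resolvent_rules:
  assumes "invertible (A - mat l)" and "R = matrix_inv (A - mat l)"
  shows "A ** R = mat 1 + l *\<^sub>m R" "R ** A = mat 1 + l *\<^sub>m R"
proof -
  have mat: "mat l = l *\<^sub>m (mat 1 :: complex ^ 'n ^ 'n)"
    by (simp add: cscale_def mat_def vec_eq_iff)
  have "(A - mat l) ** R = mat 1" "R ** (A - mat l) = mat 1"
    using assms by (simp_all add: matrix_inv_left matrix_inv_right)
  then show "A ** R = mat 1 + l *\<^sub>m R" "R ** A = mat 1 + l *\<^sub>m R"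
    by (simp_all add: mat mat_expand algebra_simps)
qed

lemma wave_x:
  assumes "invertible (A - mat l)" and R: "R = matrix_inv (A - mat l)"
  shows "- (\<i> *\<^sub>m (B ** R ** (P ** c0 + A ** P ** c1) + - (q_dressed c0 c1 ** B + c1 ** B ** A) ** R ** P))
    = (mat 1 - \<i> *\<^sub>m (B ** R ** P)) ** (c0 + l *\<^sub>m c1)
      - (q_dressed c0 c1 + l *\<^sub>m c1) ** (mat 1 - \<i> *\<^sub>m (B ** R ** P))"
proof -
  note AR = resolvent_rules[OF assms]
  show ?thesis
    by (simp add: q_dressed_def X0_def mat_expand AR AR[THEN mult_eq_extend] algebra_simps)
qed

text \<open>Since \<open>l A\<inverse> (A - l)\<inverse> = (A - l)\<inverse> - A\<inverse>\<close>, the transfer function at \<open>l\<close> enters together with its value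
  \<open>I - X\<close> at \<open>0\<close>, and the contribution of the latter vanishes because \<open>I - X\<close> intertwines \<open>Q\<close> with the
  dressed \<open>Q\<close>.\<close>

lemma wave_t:
  assumes "invertible (A - mat l)" and R: "R = matrix_inv (A - mat l)" and l: "l \<noteq> 0"
  shows "- (\<i> *\<^sub>m (B ** R ** (Ai ** P ** Q) + - (Q_dressed Q ** B ** Ai) ** R ** P))
    = (1 / l) *\<^sub>m ((mat 1 - \<i> *\<^sub>m (B ** R ** P)) ** Q - Q_dressed Q ** (mat 1 - \<i> *\<^sub>m (B ** R ** P)))"
proof -
  note AR = resolvent_rules[OF assms(1,2)]
  have "Ai ** (A ** R) = Ai + l *\<^sub>m (Ai ** R)" "(R ** A) ** Ai = Ai + l *\<^sub>m (R ** Ai)"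
    unfolding AR by (simp_all add: mat_expand)
  then have "R = Ai + l *\<^sub>m (Ai ** R)" "R = Ai + l *\<^sub>m (R ** Ai)"
    by (simp_all add: mat_expand inverse_simps)
  then have "l *\<^sub>m (Ai ** R) = R - Ai" "l *\<^sub>m (R ** Ai) = R - Ai"
    by (simp_all add: algebra_simps)
  then have "(1 / l) *\<^sub>m l *\<^sub>m (Ai ** R) = (1 / l) *\<^sub>m (R - Ai)"
      "(1 / l) *\<^sub>m l *\<^sub>m (R ** Ai) = (1 / l) *\<^sub>m (R - Ai)"
    by simp_all
  then have AiR: "Ai ** R = (1 / l) *\<^sub>m (R - Ai)" "R ** Ai = (1 / l) *\<^sub>m (R - Ai)"
    using l by (simp_all only: cscale_cscale) (simp_all add: cscale_one)
  let ?W = "mat 1 - \<i> *\<^sub>m (B ** R ** P)"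
  have "- (\<i> *\<^sub>m (B ** R ** (Ai ** P ** Q) + - (Q_dressed Q ** B ** Ai) ** R ** P))
      = (1 / l) *\<^sub>m (?W ** Q - Q_dressed Q ** ?W + (Q_dressed Q - Q + X ** Q - Q_dressed Q ** X))"
    by (simp add: X_def mat_expand AiR AiR[THEN mult_eq_extend] algebra_simps)
  then show ?thesis by (simp add: Q_dressed_X)
qed

end

section \<open>The signature matrix and block structure\<close>

lemma jmat_nth:
  "(jmat :: ('m1::finite, 'm2::finite) blockmat) $ i $ k =
    (if i = k then (case i of Inl _ \<Rightarrow> 1 | Inr _ \<Rightarrow> - 1) else 0)"
  by (auto simp: jmat_def block_def mat_def split: sum.splits)

lemma jmat_mult_nth: "(jmat ** M) $ i $ k = (case i of Inl _ \<Rightarrow> M $ i $ k | Inr _ \<Rightarrow> - (M $ i $ k))"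
  by (simp add: matrix_matrix_mult_def jmat_nth if_distrib[of "\<lambda>a. a * _"] cong: if_cong split: sum.split)

lemma mult_jmat_nth: "(M ** jmat) $ i $ k = (case k of Inl _ \<Rightarrow> M $ i $ k | Inr _ \<Rightarrow> - (M $ i $ k))"
  by (simp add: matrix_matrix_mult_def jmat_nth if_distrib[of "\<lambda>a. _ * a"] cong: if_cong split: sum.split)

lemma jmat_square: "jmat ** jmat = (mat 1 :: ('m1::finite, 'm2::finite) blockmat)"
  by (auto simp: vec_eq_iff jmat_mult_nth jmat_nth mat_def split: sum.split)

lemma ctranspose_jmat: "ctranspose jmat = (jmat :: ('m1::finite, 'm2::finite) blockmat)"
  by (auto simp: vec_eq_iff ctranspose_def jmat_nth split: sum.split)

lemma block_diagonal_commutes: "jmat ** block M 0 0 M' = block M 0 0 M' ** jmat"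
  by (auto simp: vec_eq_iff jmat_mult_nth mult_jmat_nth block_def split: sum.split)

lemma block_off_diagonal_anticommutes: "block 0 M M' 0 ** jmat = - (jmat ** block 0 M M' 0)"
  by (auto simp: vec_eq_iff jmat_mult_nth mult_jmat_nth block_def split: sum.split)

lemma commutes_imp_block_diagonal:
  assumes "jmat ** M = M ** jmat"
  shows "M = block (\<chi> r c. M $ Inl r $ Inl c) 0 0 (\<chi> r c. M $ Inr r $ Inr c)"
proof -
  have *: "(jmat ** M) $ i $ k = (M ** jmat) $ i $ k" for i k by (simp add: assms)
  show ?thesis
    using *[of "Inl _" "Inr _"] *[of "Inr _" "Inl _"]
    by (auto simp: vec_eq_iff jmat_mult_nth mult_jmat_nth block_def split: sum.splits)
qed

lemma anticommutes_imp_block_off_diagonal: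
  assumes "M ** jmat = - (jmat ** M)"
  shows "M = block 0 (\<chi> r c. M $ Inl r $ Inr c) (\<chi> r c. M $ Inr r $ Inl c) 0"
proof -
  have *: "(M ** jmat) $ i $ k = - (jmat ** M) $ i $ k" for i k by (simp add: assms)
  show ?thesis
    using *[of "Inl _" "Inl _"] *[of "Inr _" "Inr _"]
    by (auto simp: vec_eq_iff jmat_mult_nth mult_jmat_nth block_def split: sum.splits)
qed

lemma ctranspose_block_off_diagonal:
  "ctranspose (block 0 M M' 0) = block 0 (ctranspose M') (ctranspose M) 0"
  by (auto simp: vec_eq_iff ctranspose_def block_def split: sum.split)

lemma mpow_jmat_rules:
  assumes "p \<in> {0, 1}"
  shows "mpow jmat p ** mpow jmat p = (mat 1 :: ('m1::finite, 'm2::finite) blockmat)"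
    and "mpow jmat p ** jmat = (jmat ** mpow jmat p :: ('m1::finite, 'm2::finite) blockmat)"
    and "ctranspose (mpow jmat p) = (mpow jmat p :: ('m1::finite, 'm2::finite) blockmat)"
  using assms by (auto simp: jmat_square ctranspose_jmat ctranspose_mat)

text \<open>With \<open>W = V\<^sub>t\<close> the left-hand side is \<open>\<i> j R\<^sub>x - j\<^sup>p W\<^sub>x\<close> as prescribed by the two evolution equations.
  The identity serves twice: forwards, to find \<open>Q\<^sub>x\<close> for the given solution, and backwards, to read off
  the equations for the transformed functions.\<close>

lemma zero_curvature_algebra:
  fixes R V W :: "('m1::finite, 'm2::finite) blockmat"
  assumes p: "p \<in> {0, 1}" and R: "jmat ** R = R ** jmat" and V: "V ** jmat = - (jmat ** V)"
    and W: "W ** jmat = - (jmat ** W)"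
    and Q: "Q = \<i> *\<^sub>m (jmat ** R) - mpow jmat p ** W"
    and q: "q = (\<i> / 2) *\<^sub>m (mpow jmat (p + 1) ** V)"
  shows "\<i> *\<^sub>m (jmat ** (((-1) ^ p / 2) *\<^sub>R (V ** W + W ** V)))
      - mpow jmat p ** ((1 / 2) *\<^sub>R (V ** R + R ** V)) = Q ** q - q ** Q"
proof -
  have jj: "jmat ** jmat = (mat 1 :: ('m1, 'm2) blockmat)" by (rule jmat_square)
  note j = jj R[symmetric] V W
  have "p = 0 \<or> p = 1" using p by auto
  then show ?thesis
    by (elim disjE) (simp_all add: Q q mat_expand j j[THEN mult_eq_extend] scaleR_eq_cscale algebra_simps)
qed

lemma vector_derivative_unique_local:
  assumes "(f has_vector_derivative f') (at t)" "(g has_vector_derivative g') (at t)"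
    and "open T" "t \<in> T" "\<And>s. s \<in> T \<Longrightarrow> f s = g s"
  shows "f' = g'"
  using has_vector_derivative_transform_within_open[OF assms(1,3,4), of g] assms(2,5)
  by (metis vector_derivative_at)

lemma has_vector_derivative_reflect:
  assumes "(f has_vector_derivative f') (at (- x))"
  shows "((\<lambda>y. f (- y)) has_vector_derivative - f') (at x)"
proof -
  have "(uminus has_vector_derivative - 1) (at (x :: real))"
    by (auto intro!: derivative_eq_intros)
  from vector_diff_chain_at[OF this assms] show ?thesis by (simp add: o_def)
qed

section \<open>Multiplication operators and exact differentials\<close>

definition left_mult :: "complex ^ 'n ^ 'n \<Rightarrow> (complex ^ 'm ^ 'n) \<Rightarrow>\<^sub>L (complex ^ 'm ^ 'n)" where
  "left_mult M = Blinfun (\<lambda>u. M ** u)"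

definition right_mult :: "complex ^ 'm ^ 'm \<Rightarrow> (complex ^ 'm ^ 'n) \<Rightarrow>\<^sub>L (complex ^ 'm ^ 'n)" where
  "right_mult M = Blinfun (\<lambda>u. u ** M)"

lemma left_mult_apply: "left_mult M u = M ** u"
  unfolding left_mult_def
  by (simp add: bounded_linear_Blinfun_apply
      bounded_bilinear.bounded_linear_right[OF bounded_bilinear_matrix_mult])

lemma right_mult_apply: "right_mult M u = u ** M"
  unfolding right_mult_def
  by (simp add: bounded_linear_Blinfun_apply
      bounded_bilinear.bounded_linear_left[OF bounded_bilinear_matrix_mult])

lemma bounded_linear_left_mult: "bounded_linear left_mult"
  unfolding linear_conv_bounded_linear[symmetric]
  by (auto intro!: linearI blinfun_eqI
      simp: left_mult_apply blinfun.bilinear_simps mat_expand scaleR_eq_cscale)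

lemma bounded_linear_right_mult: "bounded_linear right_mult"
  unfolding linear_conv_bounded_linear[symmetric]
  by (auto intro!: linearI blinfun_eqI
      simp: right_mult_apply blinfun.bilinear_simps mat_expand scaleR_eq_cscale)

text \<open>Turns the inhomogeneous system \<open>u\<^sub>x = M\<close> into a homogeneous linear one for \<open>(u, 1)\<close>.\<close>

definition source_operator :: "'a::euclidean_space \<Rightarrow> ('a \<times> real) \<Rightarrow>\<^sub>L ('a \<times> real)" where
  "source_operator M = Blinfun (\<lambda>z. (snd z *\<^sub>R M, 0))"

lemma source_operator_apply: "source_operator M z = (snd z *\<^sub>R M, 0)"
proof -
  have "bounded_linear (\<lambda>z :: 'a \<times> real. (snd z *\<^sub>R M, 0 :: real))"
    unfolding linear_conv_bounded_linear[symmetric]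
    by (auto intro!: linearI simp: scaleR_add_left)
  then show ?thesis by (simp add: source_operator_def bounded_linear_Blinfun_apply)
qed

lemma bounded_linear_source_operator: "bounded_linear source_operator"
  unfolding linear_conv_bounded_linear[symmetric]
  by (auto intro!: linearI blinfun_eqI
      simp: source_operator_apply blinfun.bilinear_simps scaleR_add_right)

text \<open>Two source operators compose to zero, so that compatibility reduces to the equality of the mixed
  derivatives \<open>\<alpha>\<^sub>t = \<beta>\<^sub>x\<close>.\<close>

theorem exact_differential:
  fixes \<alpha> \<beta> \<gamma> :: "real \<Rightarrow> real \<Rightarrow> 'a::euclidean_space"
  assumes X: "open X" "convex X" "0 \<in> X" and T: "open T" "convex T" "0 \<in> T"
    and \<alpha>: "continuous_on (X \<times> T) (\<lambda>(x, t). \<alpha> x t)" and \<beta>: "continuous_on (X \<times> T) (\<lambda>(x, t). \<beta> x t)"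
    and \<gamma>: "continuous_on (X \<times> T) (\<lambda>(x, t). \<gamma> x t)"
    and d\<alpha>: "\<And>x t. x \<in> X \<Longrightarrow> t \<in> T \<Longrightarrow> has_dt \<alpha> (\<gamma> x t) x t"
    and d\<beta>: "\<And>x t. x \<in> X \<Longrightarrow> t \<in> T \<Longrightarrow> has_dx \<beta> (\<gamma> x t) x t"
  shows "\<exists>u. u 0 0 = u0 \<and> (\<forall>x\<in>X. \<forall>t\<in>T. has_dx u (\<alpha> x t) x t \<and> has_dt u (\<beta> x t) x t)"
proof -
  note cont = bounded_linear.continuous_on[OF bounded_linear_source_operator]
  note deriv = bounded_linear.has_vector_derivative[OF bounded_linear_source_operator]
  have G: "continuous_on (X \<times> T) (\<lambda>(x, t). source_operator (\<alpha> x t))"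
    and F: "continuous_on (X \<times> T) (\<lambda>(x, t). source_operator (\<beta> x t))"
    and G': "continuous_on (X \<times> T) (\<lambda>(x, t). source_operator (\<gamma> x t))"
    using cont[OF \<alpha>] cont[OF \<beta>] cont[OF \<gamma>] by (simp_all add: case_prod_unfold)
  have "\<exists>w. continuous_on (X \<times> T) (\<lambda>(x, t). w x t) \<and> w 0 0 = (u0, 1) \<and>
    (\<forall>x\<in>X. \<forall>t\<in>T. has_dx w (source_operator (\<alpha> x t) (w x t)) x t \<and>
        has_dt w (source_operator (\<beta> x t) (w x t)) x t)"
  proof (rule frobenius_linear[where G' = "\<lambda>x t. source_operator (\<gamma> x t)" and
      F' = "\<lambda>x t. source_operator (\<gamma> x t)", OF X T G F G'])
    fix x t assume xt: "x \<in> X" "t \<in> T"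
    show "has_dt (\<lambda>x t. source_operator (\<alpha> x t)) (source_operator (\<gamma> x t)) x t"
      by (rule deriv[OF d\<alpha>[OF xt]])
    show "has_dx (\<lambda>x t. source_operator (\<beta> x t)) (source_operator (\<gamma> x t)) x t"
      by (rule deriv[OF d\<beta>[OF xt]])
    show "source_operator (\<gamma> x t) + (source_operator (\<alpha> x t) o\<^sub>L source_operator (\<beta> x t)) =
        source_operator (\<gamma> x t) + (source_operator (\<beta> x t) o\<^sub>L source_operator (\<alpha> x t))"
      by (rule blinfun_eqI) (simp add: blinfun.bilinear_simps source_operator_apply)
  qed
  then obtain w where w: "w 0 0 = (u0, 1)"
    "\<And>x t. x \<in> X \<Longrightarrow> t \<in> T \<Longrightarrow> has_dx w (source_operator (\<alpha> x t) (w x t)) x t \<and>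
        has_dt w (source_operator (\<beta> x t) (w x t)) x t"
    by blast
  have snd_deriv: "has_dx (\<lambda>x t. snd (w x t)) 0 x t \<and> has_dt (\<lambda>x t. snd (w x t)) 0 x t"
    if "x \<in> X" "t \<in> T" for x t
    using w(2)[OF that] bounded_linear.has_vector_derivative[OF bounded_linear_snd]
    by (fastforce simp: source_operator_apply)
  have snd: "snd (w x t) = 1" if xt: "x \<in> X" "t \<in> T" for x t
    using frobenius_unique[where G = "\<lambda>_ _. 0" and F = "\<lambda>_ _. 0" and u = "\<lambda>x t. snd (w x t)"
        and v = "\<lambda>_ _. 1", OF X(2,3) T(2,3) _ _ _ _ _ xt] snd_deriv
    by (simp add: w(1))
  show ?thesis
  proof (intro exI[of _ "\<lambda>x t. fst (w x t)"] conjI ballI)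
    show "fst (w 0 0) = u0" by (simp add: w)
    fix x t assume xt: "x \<in> X" "t \<in> T"
    have "has_dx (\<lambda>x t. fst (w x t)) (fst (source_operator (\<alpha> x t) (w x t))) x t"
      "has_dt (\<lambda>x t. fst (w x t)) (fst (source_operator (\<beta> x t) (w x t))) x t"
      using w(2)[OF xt] by (auto intro: bounded_linear.has_vector_derivative[OF bounded_linear_fst])
    then show "has_dx (\<lambda>x t. fst (w x t)) (\<alpha> x t) x t" "has_dt (\<lambda>x t. fst (w x t)) (\<beta> x t) x t"
      by (simp_all add: source_operator_apply snd[OF xt])
  qed
qed

lemma same_gradient_same_function:
  fixes u v :: "real \<Rightarrow> real \<Rightarrow> 'a::euclidean_space"
  assumes X: "convex X" "0 \<in> X" and T: "convex T" "0 \<in> T"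
    and u: "\<And>x t. x \<in> X \<Longrightarrow> t \<in> T \<Longrightarrow> has_dx u (\<alpha> x t) x t \<and> has_dt u (\<beta> x t) x t"
    and v: "\<And>x t. x \<in> X \<Longrightarrow> t \<in> T \<Longrightarrow> has_dx v (\<alpha> x t) x t \<and> has_dt v (\<beta> x t) x t"
    and 0: "u 0 0 = v 0 0" and xt: "x \<in> X" "t \<in> T"
  shows "u x t = v x t"
proof -
  have "has_dx (\<lambda>x t. u x t - v x t) 0 x t \<and> has_dt (\<lambda>x t. u x t - v x t) 0 x t"
    if "x \<in> X" "t \<in> T" for x t
    using has_vector_derivative_diff[of "\<lambda>x. u x t" "\<alpha> x t" "at x" "\<lambda>x. v x t" "\<alpha> x t"]
      has_vector_derivative_diff[of "\<lambda>t. u x t" "\<beta> x t" "at t" "\<lambda>t. v x t" "\<beta> x t"]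
      u[OF that] v[OF that] by simp
  then have "u x t - v x t = 0"
    using frobenius_unique[where G = "\<lambda>_ _. 0" and F = "\<lambda>_ _. 0" and u = "\<lambda>x t. u x t - v x t"
        and v = "\<lambda>_ _. 0", OF X T _ _ _ _ _ xt] by (simp add: 0)
  then show ?thesis by simp
qed

section \<open>The linear systems of a solution\<close>

locale dispersionless_solution =
  fixes X T :: "real set" and p :: nat
    and R V :: "real \<Rightarrow> real \<Rightarrow> ('m1::finite, 'm2::finite) blockmat"
    and \<rho>1 :: "real \<Rightarrow> real \<Rightarrow> complex ^ 'm1 ^ 'm1"
    and \<rho>2 :: "real \<Rightarrow> real \<Rightarrow> complex ^ 'm2 ^ 'm2"
    and v :: "real \<Rightarrow> real \<Rightarrow> complex ^ 'm2 ^ 'm1"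
  assumes X: "open X" "convex X" "0 \<in> X" and X_symmetric: "x \<in> X \<Longrightarrow> - x \<in> X"
    and T: "open T" "convex T" "0 \<in> T"
    and p: "p \<in> {0, 1}"
    and form: "nonlocal_form (X \<times> T) R V \<rho>1 \<rho>2 v"
    and R_cont: "continuous_on (X \<times> T) (\<lambda>(x, t). R x t)"
    and V_cont: "continuous_on (X \<times> T) (\<lambda>(x, t). V x t)"
    and dtV_cont: "continuous_on (X \<times> T) (\<lambda>(x, t). dt V x t)"
    and equations: "dispersionless_eqs (X \<times> T) p R V"
begin

abbreviation J :: "('m1, 'm2) blockmat" where "J \<equiv> mpow jmat p"
abbreviation "q \<equiv> q0 p V"
abbreviation "Q \<equiv> Q_m1 p R V"

lemma jj: "jmat ** jmat = (mat 1 :: ('m1, 'm2) blockmat)"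
  by (rule jmat_square)

lemma JJ: "J ** J = mat 1" and Jj: "J ** jmat = jmat ** J" and ctranspose_J: "ctranspose J = J"
  by (rule mpow_jmat_rules[OF p])+

lemmas j_rules = jj JJ Jj

lemmas j_simps = j_rules j_rules[THEN mult_eq_extend]

context
  fixes x t :: real
  assumes xt: "x \<in> X" "t \<in> T"
begin

lemma has_dt_V: "has_dt V (dt V x t) x t"
  using equations xt by (auto simp: dispersionless_eqs_def dt_def vector_derivative_works)

lemma has_dx_R: "has_dx R (((-1) ^ p / 2) *\<^sub>R (V x t ** dt V x t + dt V x t ** V x t)) x t"
  and has_dx_dtV: "has_dx (dt V) ((1 / 2) *\<^sub>R (V x t ** R x t + R x t ** V x t)) x t"
  using equations xt by (auto simp: dispersionless_eqs_def)

lemma form_at: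
  "R x t = block (\<rho>1 x t) 0 0 (\<rho>2 x t)" "R x t = - ctranspose (R (- x) t)"
  "V x t = block 0 (v x t) (ctranspose (v (- x) t)) 0"
  using bspec[OF form[unfolded nonlocal_form_def] SigmaI[OF xt]] unfolding prod.case by blast+

lemma R_commutes: "jmat ** R x t = R x t ** jmat"
  by (simp add: form_at(1) block_diagonal_commutes)

lemma R_symmetric: "ctranspose (R (- x) t) = - R x t"
  by (subst form_at(2)) simp

lemma V_anticommutes: "V x t ** jmat = - (jmat ** V x t)"
  by (simp add: form_at(3) block_off_diagonal_anticommutes)

end

lemma V_symmetric:
  assumes xt: "x \<in> X" "t \<in> T"
  shows "ctranspose (V (- x) t) = V x t"
  using form_at(3)[OF xt] form_at(3)[OF X_symmetric[OF xt(1)] xt(2)]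
  by (simp add: ctranspose_block_off_diagonal ctranspose_ctranspose)

text \<open>The algebraic relations of \<open>V\<close> are linear and hold for all \<open>t\<close>, hence pass to \<open>V\<^sub>t\<close> by uniqueness of
  derivatives.\<close>

lemma dtV_anticommutes:
  assumes xt: "x \<in> X" "t \<in> T"
  shows "dt V x t ** jmat = - (jmat ** dt V x t)"
proof (rule vector_derivative_unique_local[OF _ _ T(1) xt(2)])
  show "((\<lambda>s. V x s ** jmat) has_vector_derivative dt V x t ** jmat) (at t)"
    using has_vector_derivative_matrix_mult[OF has_dt_V[OF xt] has_vector_derivative_const]
    by (simp add: mat_expand)
  show "((\<lambda>s. - (jmat ** V x s)) has_vector_derivative - (jmat ** dt V x t)) (at t)"
    using has_vector_derivative_minus[OF
      has_vector_derivative_matrix_mult[OF has_vector_derivative_const has_dt_V[OF xt]]]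
    by (simp add: mat_expand)
qed (rule V_anticommutes[OF xt(1)])

lemma dtV_symmetric:
  assumes xt: "x \<in> X" "t \<in> T"
  shows "ctranspose (dt V (- x) t) = dt V x t"
  by (rule vector_derivative_unique_local[OF _ _ T(1) xt(2)])
    (rule has_vector_derivative_ctranspose[OF has_dt_V[OF X_symmetric[OF xt(1)] xt(2)]],
      rule has_dt_V[OF xt], rule V_symmetric[OF xt(1)])

lemma q_cont: "continuous_on (X \<times> T) (\<lambda>(x, t). q x t)"
  using V_cont unfolding q0_def case_prod_unfold by (intro continuous_intros)

lemma Q_cont: "continuous_on (X \<times> T) (\<lambda>(x, t). Q x t)"
  using R_cont dtV_cont unfolding Q_m1_def case_prod_unfold by (intro continuous_intros)

lemma has_dt_q:
  assumes xt: "x \<in> X" "t \<in> T"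
  shows "has_dt q (q1 ** Q x t - Q x t ** q1) x t"
proof -
  have "has_dt q ((\<i> / 2) *\<^sub>m (mpow jmat (p + 1) ** dt V x t)) x t"
    unfolding q0_def
    using has_vector_derivative_matrix_mult[OF has_vector_derivative_const has_dt_V[OF xt], of "mpow jmat (p + 1)"]
    by (intro has_vector_derivative_cscale) (simp add: mat_expand)
  moreover have "(\<i> / 2) *\<^sub>m (mpow jmat (p + 1) ** dt V x t) = q1 ** Q x t - Q x t ** q1"
    using R_commutes[OF xt, symmetric] dtV_anticommutes[OF xt]
    by (simp add: q1_def Q_m1_def mat_expand j_simps flip: cscale_add_left)
  ultimately show ?thesis by simp
qed

lemma has_dx_Q:
  assumes xt: "x \<in> X" "t \<in> T"
  shows "has_dx Q (Q x t ** q x t - q x t ** Q x t) x t"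
proof -
  let ?r = "((-1) ^ p / 2) *\<^sub>R (V x t ** dt V x t + dt V x t ** V x t)"
  let ?w = "(1 / 2) *\<^sub>R (V x t ** R x t + R x t ** V x t)"
  have "has_dx Q (\<i> *\<^sub>m (jmat ** ?r + 0 ** R x t) - (J ** ?w + 0 ** dt V x t)) x t"
    unfolding Q_m1_def
    by (intro has_vector_derivative_diff has_vector_derivative_cscale
        has_vector_derivative_matrix_mult has_vector_derivative_const has_dx_R has_dx_dtV xt)
  moreover have "\<i> *\<^sub>m (jmat ** ?r) - J ** ?w = Q x t ** q x t - q x t ** Q x t"
    by (rule zero_curvature_algebra[OF p R_commutes V_anticommutes dtV_anticommutes])
      (simp_all add: xt Q_m1_def q0_def)
  ultimately show ?thesis by (simp add: matrix_mult_zero_left)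
qed

text \<open>The reflection symmetries that make the equations for \<open>\<Pi>(-x,t)\<^sup>*\<close> local.\<close>

lemma q_symmetric:
  assumes xt: "x \<in> X" "t \<in> T"
  shows "J ** ctranspose (q (- x) t) = q x t ** J"
proof -
  have "p = 0 \<or> p = 1" using p by auto
  then show ?thesis
    using V_anticommutes[OF xt]
    by (elim disjE) (simp_all add: q0_def mat_expand ctranspose_expand ctranspose_jmat
        V_symmetric[OF xt] j_simps jj[THEN mult_eq_extend] uminus_cscale)
qed

lemma Q_symmetric:
  assumes xt: "x \<in> X" "t \<in> T"
  shows "J ** ctranspose (Q (- x) t) = Q x t ** J"
proof -
  have "p = 0 \<or> p = 1" using p by auto
  then show ?thesis
    using R_commutes[OF xt, symmetric]
    by (elim disjE) (simp_all add: Q_m1_def mat_expand ctranspose_expand ctranspose_jmat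
        R_symmetric[OF xt] dtV_symmetric[OF xt] jj[THEN mult_eq_extend])
qed

lemma q1_symmetric: "J ** ctranspose q1 = - (q1 ** J)"
  by (simp add: q1_def ctranspose_expand ctranspose_jmat mat_expand j_simps)

lemma G_aux_eq: "G_aux p V lam x t = - (q x t + lam *\<^sub>m q1)"
  by (simp add: G_aux_def q0_def q1_def mat_expand mult.commute)

lemma F_aux_eq: "F_aux p R' V' lam x t = - ((1 / lam) *\<^sub>m Q_m1 p R' V' x t)"
  by (simp add: F_aux_def Q_m1_def mat_expand)

text \<open>At every \<open>\<lambda> \<noteq> 0\<close> the compatibility of \<open>G\<close> and \<open>F\<close> is the pair of identities \<open>has_dt_q\<close> and
  \<open>has_dx_Q\<close>.\<close>

theorem wave_function_well_defined:
  assumes lam: "lam \<noteq> 0" and w0: "det w0 \<noteq> 0"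
  shows "well_defined_on (X \<times> T) (\<lambda>w. wave_function (X \<times> T) p R V lam w \<and> w 0 0 = w0)"
proof -
  note cont = bounded_linear.continuous_on[OF bounded_linear_left_mult]
  note deriv = bounded_linear.has_vector_derivative[OF bounded_linear_left_mult]
  let ?G = "\<lambda>x t. left_mult (- (q x t + lam *\<^sub>m q1)) :: ('m1, 'm2) blockmat \<Rightarrow>\<^sub>L ('m1, 'm2) blockmat"
  let ?F = "\<lambda>x t. left_mult (- ((1 / lam) *\<^sub>m Q x t)) :: ('m1, 'm2) blockmat \<Rightarrow>\<^sub>L ('m1, 'm2) blockmat"
  let ?G' = "\<lambda>x t. left_mult (- (q1 ** Q x t - Q x t ** q1)) :: ('m1, 'm2) blockmat \<Rightarrow>\<^sub>L ('m1, 'm2) blockmat"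
  let ?F' = "\<lambda>x t. left_mult (- ((1 / lam) *\<^sub>m (Q x t ** q x t - q x t ** Q x t)))
    :: ('m1, 'm2) blockmat \<Rightarrow>\<^sub>L ('m1, 'm2) blockmat"
  have G: "continuous_on (X \<times> T) (\<lambda>(x, t). ?G x t)"
    using q_cont unfolding case_prod_unfold by (intro cont continuous_intros)
  have F: "continuous_on (X \<times> T) (\<lambda>(x, t). ?F x t)"
    using Q_cont unfolding case_prod_unfold by (intro cont continuous_intros)
  have G': "continuous_on (X \<times> T) (\<lambda>(x, t). ?G' x t)"
    using Q_cont unfolding case_prod_unfold by (intro cont continuous_intros)
  have wave: "wave_function (X \<times> T) p R V lam w \<longleftrightarrow> det (w 0 0) \<noteq> 0 \<and>
      (\<forall>x\<in>X. \<forall>t\<in>T. has_dx w (?G x t (w x t)) x t \<and> has_dt w (?F x t (w x t)) x t)" for w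
    by (auto simp: wave_function_def G_aux_eq F_aux_eq left_mult_apply)
  have "\<exists>w. continuous_on (X \<times> T) (\<lambda>(x, t). w x t) \<and> w 0 0 = w0 \<and>
      (\<forall>x\<in>X. \<forall>t\<in>T. has_dx w (?G x t (w x t)) x t \<and> has_dt w (?F x t (w x t)) x t)"
  proof (rule frobenius_linear[where G' = ?G' and F' = ?F', OF X T G F G'])
    fix x t assume xt: "x \<in> X" "t \<in> T"
    have "has_dt (\<lambda>x t. q x t + lam *\<^sub>m q1) (q1 ** Q x t - Q x t ** q1) x t"
      using has_vector_derivative_add[OF has_dt_q[OF xt] has_vector_derivative_const] by simp
    then show "has_dt ?G (?G' x t) x t"
      by (intro deriv has_vector_derivative_minus)
    show "has_dx ?F (?F' x t) x t"
      by (intro deriv has_vector_derivative_minus has_vector_derivative_cscale has_dx_Q xt)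
    show "?G' x t + (?G x t o\<^sub>L ?F x t) = ?F' x t + (?F x t o\<^sub>L ?G x t)"
      by (rule blinfun_eqI)
        (simp add: blinfun.bilinear_simps left_mult_apply mat_expand lam algebra_simps)
  qed
  then have "\<exists>w. wave_function (X \<times> T) p R V lam w \<and> w 0 0 = w0"
    using w0 unfolding wave by metis
  moreover have "f x t = g x t"
    if "wave_function (X \<times> T) p R V lam f \<and> f 0 0 = w0" "wave_function (X \<times> T) p R V lam g \<and> g 0 0 = w0"
      and xt: "x \<in> X" "t \<in> T" for f g x t
    by (rule frobenius_unique[OF X(2,3) T(2,3) G F _ _ _ xt]) (use that in \<open>auto simp: wave\<close>)
  ultimately show ?thesis by (auto simp: well_defined_on_def)
qed

end

locale darboux_seed = dispersionless_solution X T p R V \<rho>1 \<rho>2 v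
  for X T p and R V :: "real \<Rightarrow> real \<Rightarrow> ('m1::finite, 'm2::finite) blockmat" and \<rho>1 \<rho>2 v +
  fixes A :: "complex ^ 'n ^ 'n"
  assumes inv_A: "invertible A"
begin

abbreviation "Ai \<equiv> matrix_inv A"
abbreviation "C \<equiv> ctranspose A"
abbreviation "Ci \<equiv> matrix_inv C"

lemma inv_C: "invertible C" and Ci_eq: "ctranspose Ai = Ci"
  using invertible_ctranspose[OF inv_A] by auto

lemmas A_rules = matrix_inv_left[OF inv_A] matrix_inv_right[OF inv_A]
  matrix_inv_left[OF inv_C] matrix_inv_right[OF inv_C]

lemmas A_simps = A_rules A_rules[THEN mult_eq_extend]

text \<open>The system for \<open>\<Pi>\<close> is the one for \<open>w\<inverse>\<close> with the spectral parameter replaced by \<open>A\<close> acting from the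
  left, so the same two identities make it compatible. An arbitrary solution is jointly continuous
  because it agrees with the constructed one.\<close>

lemma Pi_solution:
  fixes P0 :: "complex ^ ('m1 + 'm2) ^ 'n"
  shows "well_defined_on (X \<times> T) (\<lambda>P. Pi_system (X \<times> T) p R V A P \<and> P 0 0 = P0)"
    and "Pi_system (X \<times> T) p R V A P \<Longrightarrow> continuous_on (X \<times> T) (\<lambda>(x, t). P x t)"
proof -
  note cont = bounded_linear.continuous_on[OF bounded_linear_right_mult]
    bounded_bilinear.continuous_on[OF bounded_bilinear_blinfun_compose]
  note deriv = bounded_linear.has_vector_derivative[OF bounded_linear_right_mult]
  let ?G = "\<lambda>x t. right_mult (q x t) + (left_mult A o\<^sub>L right_mult q1) ::
    (complex ^ ('m1 + 'm2) ^ 'n) \<Rightarrow>\<^sub>L (complex ^ ('m1 + 'm2) ^ 'n)"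
  let ?F = "\<lambda>x t. left_mult Ai o\<^sub>L right_mult (Q x t) ::
    (complex ^ ('m1 + 'm2) ^ 'n) \<Rightarrow>\<^sub>L (complex ^ ('m1 + 'm2) ^ 'n)"
  let ?G' = "\<lambda>x t. right_mult (q1 ** Q x t - Q x t ** q1) ::
    (complex ^ ('m1 + 'm2) ^ 'n) \<Rightarrow>\<^sub>L (complex ^ ('m1 + 'm2) ^ 'n)"
  let ?F' = "\<lambda>x t. left_mult Ai o\<^sub>L right_mult (Q x t ** q x t - q x t ** Q x t) ::
    (complex ^ ('m1 + 'm2) ^ 'n) \<Rightarrow>\<^sub>L (complex ^ ('m1 + 'm2) ^ 'n)"
  have G: "continuous_on (X \<times> T) (\<lambda>(x, t). ?G x t)"
    using q_cont unfolding case_prod_unfold by (intro cont continuous_intros)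
  have F: "continuous_on (X \<times> T) (\<lambda>(x, t). ?F x t)"
    using Q_cont unfolding case_prod_unfold by (intro cont continuous_intros)
  have G': "continuous_on (X \<times> T) (\<lambda>(x, t). ?G' x t)"
    using Q_cont unfolding case_prod_unfold by (intro cont continuous_intros)
  have system: "Pi_system (X \<times> T) p R V A P \<longleftrightarrow>
      (\<forall>x\<in>X. \<forall>t\<in>T. has_dx P (?G x t (P x t)) x t \<and> has_dt P (?F x t (P x t)) x t)" for P
    by (auto simp: Pi_system_def left_mult_apply right_mult_apply blinfun.bilinear_simps matrix_mul_assoc)
  have ex: "\<exists>P. continuous_on (X \<times> T) (\<lambda>(x, t). P x t) \<and> P 0 0 = P0 \<and>
      (\<forall>x\<in>X. \<forall>t\<in>T. has_dx P (?G x t (P x t)) x t \<and> has_dt P (?F x t (P x t)) x t)" for P0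
  proof (rule frobenius_linear[where G' = ?G' and F' = ?F', OF X T G F G'])
    fix x t assume xt: "x \<in> X" "t \<in> T"
    show "has_dt ?G (?G' x t) x t"
      using has_vector_derivative_add[OF deriv[OF has_dt_q[OF xt]] has_vector_derivative_const] by simp
    show "has_dx ?F (?F' x t) x t"
      using bounded_linear.has_vector_derivative[OF
          bounded_bilinear.bounded_linear_right[OF bounded_bilinear_blinfun_compose] deriv[OF has_dx_Q[OF xt]]] .
    show "?G' x t + (?G x t o\<^sub>L ?F x t) = ?F' x t + (?F x t o\<^sub>L ?G x t)"
      by (rule blinfun_eqI)
        (simp add: blinfun.bilinear_simps left_mult_apply right_mult_apply mat_expand A_simps algebra_simps)
  qed
  have unique: "P x t = P' x t" if "Pi_system (X \<times> T) p R V A P" "Pi_system (X \<times> T) p R V A P'"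
    "P 0 0 = P' 0 0" "x \<in> X" "t \<in> T" for P P' x t
    by (rule frobenius_unique[OF X(2,3) T(2,3) G F _ _ _ that(4,5)]) (use that in \<open>auto simp: system\<close>)
  show "well_defined_on (X \<times> T) (\<lambda>P. Pi_system (X \<times> T) p R V A P \<and> P 0 0 = P0)"
    unfolding well_defined_on_def
  proof (intro conjI allI impI ballI)
    show "\<exists>P. Pi_system (X \<times> T) p R V A P \<and> P 0 0 = P0"
      using ex[of P0] unfolding system by blast
    fix P P' and z :: "real \<times> real"
    assume "Pi_system (X \<times> T) p R V A P \<and> P 0 0 = P0" "Pi_system (X \<times> T) p R V A P' \<and> P' 0 0 = P0"
      "z \<in> X \<times> T"
    then show "case z of (x, t) \<Rightarrow> P x t = P' x t"
      using unique[of P P' "fst z" "snd z"] by (simp add: case_prod_unfold mem_Times_iff)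
  qed
  show "continuous_on (X \<times> T) (\<lambda>(x, t). P x t)" if P: "Pi_system (X \<times> T) p R V A P" for P
  proof -
    obtain P' where P': "continuous_on (X \<times> T) (\<lambda>(x, t). P' x t)" "P' 0 0 = P 0 0"
      "Pi_system (X \<times> T) p R V A P'"
      using ex[of "P 0 0"] unfolding system by blast
    show ?thesis
      by (rule continuous_on_cong[THEN iffD1, OF refl _ P'(1)])
        (use unique[OF P'(3) P P'(2)] in auto)
  qed
qed

end

locale darboux_pi = darboux_seed X T p R V \<rho>1 \<rho>2 v A
  for X T p and R V :: "real \<Rightarrow> real \<Rightarrow> ('m1::finite, 'm2::finite) blockmat" and \<rho>1 \<rho>2 v
    and A :: "complex ^ 'n ^ 'n" +
  fixes P :: "real \<Rightarrow> real \<Rightarrow> complex ^ ('m1 + 'm2) ^ 'n"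
  assumes P_system: "Pi_system (X \<times> T) p R V A P"
begin

definition N :: "real \<Rightarrow> real \<Rightarrow> complex ^ 'n ^ ('m1 + 'm2)" where
  "N x t = J ** ctranspose (P (- x) t)"

lemma has_dx_P: "has_dx P (P x t ** q x t + A ** P x t ** q1) x t"
  and has_dt_P: "has_dt P (Ai ** P x t ** Q x t) x t" if "x \<in> X" "t \<in> T"
  using P_system that by (auto simp: Pi_system_def)

lemma has_dx_N:
  assumes xt: "x \<in> X" "t \<in> T"
  shows "has_dx N (- (q x t ** N x t) + q1 ** N x t ** C) x t"
proof -
  have "has_dx N (J ** ctranspose (- (P (- x) t ** q (- x) t + A ** P (- x) t ** q1))) x t"
    unfolding N_def
    using has_vector_derivative_matrix_mult[OF has_vector_derivative_const
      has_vector_derivative_ctranspose[OF has_vector_derivative_reflect[OF has_dx_P[OF X_symmetric[OF xt(1)] xt(2)]]], of J]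
    by (simp add: matrix_mult_zero_left)
  moreover have "J ** ctranspose (- (P (- x) t ** q (- x) t + A ** P (- x) t ** q1))
      = - (q x t ** N x t) + q1 ** N x t ** C"
    by (simp add: N_def ctranspose_expand mat_expand q_symmetric[OF xt, THEN mult_eq_extend]
        q1_symmetric[THEN mult_eq_extend])
  ultimately show ?thesis by simp
qed

lemma has_dt_N:
  assumes xt: "x \<in> X" "t \<in> T"
  shows "has_dt N (Q x t ** N x t ** Ci) x t"
proof -
  have "has_dt N (J ** ctranspose (Ai ** P (- x) t ** Q (- x) t)) x t"
    unfolding N_def
    using has_vector_derivative_matrix_mult[OF has_vector_derivative_const
      has_vector_derivative_ctranspose[OF has_dt_P[OF X_symmetric[OF xt(1)] xt(2)]], of J]
    by (simp add: matrix_mult_zero_left)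
  moreover have "J ** ctranspose (Ai ** P (- x) t ** Q (- x) t) = Q x t ** N x t ** Ci"
    by (simp add: N_def ctranspose_expand mat_expand Q_symmetric[OF xt, THEN mult_eq_extend] Ci_eq)
  ultimately show ?thesis by simp
qed

lemma N_cont: "continuous_on (X \<times> T) (\<lambda>(x, t). N x t)"
proof -
  have "continuous_on (X \<times> T) (\<lambda>z. (\<lambda>(x, t). P x t) (- fst z, snd z))"
    by (rule continuous_on_compose2[OF Pi_solution(2)[OF P_system]])
      (auto intro!: continuous_intros X_symmetric)
  then show ?thesis
    unfolding N_def case_prod_unfold by (intro continuous_intros) simp
qed

definition S_x where "S_x x t = \<i> *\<^sub>m (P x t ** q1 ** N x t)"
definition S_t where "S_t x t = \<i> *\<^sub>m (Ai ** P x t ** Q x t ** N x t ** Ci)"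

lemma S_system_iff:
  "S_system (X \<times> T) p R V A P S \<longleftrightarrow> (\<forall>x\<in>X. \<forall>t\<in>T. has_dx S (S_x x t) x t \<and> has_dt S (S_t x t) x t)"
  by (auto simp: S_system_def S_x_def S_t_def N_def matrix_mul_assoc)

text \<open>Both mixed derivatives of \<open>S\<close> equal \<open>\<i> (A\<inverse> \<Pi> Q q\<^sub>1 N + \<Pi> q\<^sub>1 Q N (A\<^sup>*)\<inverse>)\<close>.\<close>

theorem S_well_defined:
  "well_defined_on (X \<times> T) (\<lambda>S. S_system (X \<times> T) p R V A P S \<and> S 0 0 = S0)"
proof -
  let ?\<gamma> = "\<lambda>x t. \<i> *\<^sub>m (Ai ** P x t ** Q x t ** q1 ** N x t + P x t ** q1 ** Q x t ** N x t ** Ci)"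
  note cont = Pi_solution(2)[OF P_system, unfolded case_prod_unfold] N_cont[unfolded case_prod_unfold]
    Q_cont[unfolded case_prod_unfold]
  have \<alpha>: "continuous_on (X \<times> T) (\<lambda>(x, t). S_x x t)"
    and \<beta>: "continuous_on (X \<times> T) (\<lambda>(x, t). S_t x t)"
    and \<gamma>: "continuous_on (X \<times> T) (\<lambda>(x, t). ?\<gamma> x t)"
    unfolding S_x_def S_t_def case_prod_unfold by (intro continuous_intros cont)+
  have "\<exists>S. S 0 0 = S0 \<and> (\<forall>x\<in>X. \<forall>t\<in>T. has_dx S (S_x x t) x t \<and> has_dt S (S_t x t) x t)"
  proof (rule exact_differential[where \<gamma> = ?\<gamma>, OF X T \<alpha> \<beta> \<gamma>])
    fix x t assume xt: "x \<in> X" "t \<in> T"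
    have "has_dt S_x (\<i> *\<^sub>m (P x t ** q1 ** (Q x t ** N x t ** Ci)
        + (P x t ** 0 + Ai ** P x t ** Q x t ** q1) ** N x t)) x t"
      unfolding S_x_def
      by (intro has_vector_derivative_cscale has_vector_derivative_matrix_mult
          has_vector_derivative_const has_dt_P has_dt_N xt)
    then show "has_dt S_x (?\<gamma> x t) x t"
      by (simp add: mat_expand add.commute)
    have "has_dx S_t (\<i> *\<^sub>m (Ai ** P x t ** Q x t ** N x t ** 0
        + (Ai ** P x t ** Q x t ** (- (q x t ** N x t) + q1 ** N x t ** C)
          + (Ai ** P x t ** (Q x t ** q x t - q x t ** Q x t)
            + (Ai ** (P x t ** q x t + A ** P x t ** q1) + 0 ** P x t) ** Q x t) ** N x t) ** Ci)) x t"
      unfolding S_t_def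
      by (intro has_vector_derivative_cscale has_vector_derivative_matrix_mult
          has_vector_derivative_const has_dx_P has_dx_N has_dx_Q xt)
    then show "has_dx S_t (?\<gamma> x t) x t"
      by (simp add: mat_expand A_simps algebra_simps)
  qed
  moreover have "f x t = g x t"
    if "S_system (X \<times> T) p R V A P f" "S_system (X \<times> T) p R V A P g" "f 0 0 = S0" "g 0 0 = S0"
      and xt: "x \<in> X" "t \<in> T" for f g x t
    by (rule same_gradient_same_function[OF X(2,3) T(2,3) _ _ _ xt, where \<alpha> = S_x and \<beta> = S_t])
      (use that in \<open>auto simp: S_system_iff\<close>)
  ultimately show ?thesis by (auto simp: well_defined_on_def S_system_iff)
qed

end

section \<open>The transformed functions\<close>

locale darboux = darboux_pi X T p R V \<rho>1 \<rho>2 v A P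
  for X T p and R V :: "real \<Rightarrow> real \<Rightarrow> ('m1::finite, 'm2::finite) blockmat" and \<rho>1 \<rho>2 v
    and A :: "complex ^ 'n ^ 'n" and P :: "real \<Rightarrow> real \<Rightarrow> complex ^ ('m1 + 'm2) ^ 'n" +
  fixes S :: "real \<Rightarrow> real \<Rightarrow> complex ^ 'n ^ 'n"
  assumes S_sys: "S_system (X \<times> T) p R V A P S"
    and S0: "S 0 0 = - ctranspose (S 0 0)" and inv_S0: "invertible (S 0 0)"
    and node0: "A ** S 0 0 + S 0 0 ** ctranspose A = \<i> *\<^sub>m (P 0 0 ** mpow jmat p ** ctranspose (P 0 0))"
begin

lemma has_dx_S: "has_dx S (S_x x t) x t" and has_dt_S: "has_dt S (S_t x t) x t"
  if "x \<in> X" "t \<in> T"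
  using S_sys that by (auto simp: S_system_iff)

text \<open>Both sides have the gradient \<open>A S\<^sub>x + S\<^sub>x A\<^sup>*\<close>, \<open>A S\<^sub>t + S\<^sub>t A\<^sup>*\<close> and agree at the origin.\<close>

theorem node_identity:
  assumes xt: "x \<in> X" "t \<in> T"
  shows "A ** S x t + S x t ** C = \<i> *\<^sub>m (P x t ** N x t)"
proof (rule same_gradient_same_function[OF X(2,3) T(2,3) _ _ _ xt,
      where \<alpha> = "\<lambda>x t. A ** S_x x t + S_x x t ** C" and \<beta> = "\<lambda>x t. A ** S_t x t + S_t x t ** C"])
  fix x t assume xt: "x \<in> X" "t \<in> T"
  have "has_dx (\<lambda>x t. A ** S x t + S x t ** C) (A ** S_x x t + 0 ** S x t + (S x t ** 0 + S_x x t ** C)) x t"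
    "has_dt (\<lambda>x t. A ** S x t + S x t ** C) (A ** S_t x t + 0 ** S x t + (S x t ** 0 + S_t x t ** C)) x t"
    by (intro has_vector_derivative_add has_vector_derivative_matrix_mult has_vector_derivative_const
        has_dx_S has_dt_S xt)+
  then show "has_dx (\<lambda>x t. A ** S x t + S x t ** C) (A ** S_x x t + S_x x t ** C) x t \<and>
      has_dt (\<lambda>x t. A ** S x t + S x t ** C) (A ** S_t x t + S_t x t ** C) x t"
    by (simp add: mat_expand)
  have "has_dx (\<lambda>x t. \<i> *\<^sub>m (P x t ** N x t)) (\<i> *\<^sub>m (P x t ** (- (q x t ** N x t) + q1 ** N x t ** C)
        + (P x t ** q x t + A ** P x t ** q1) ** N x t)) x t"
    "has_dt (\<lambda>x t. \<i> *\<^sub>m (P x t ** N x t)) (\<i> *\<^sub>m (P x t ** (Q x t ** N x t ** Ci)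
        + Ai ** P x t ** Q x t ** N x t)) x t"
    by (intro has_vector_derivative_cscale has_vector_derivative_matrix_mult
        has_dx_P has_dt_P has_dx_N has_dt_N xt)+
  then show "has_dx (\<lambda>x t. \<i> *\<^sub>m (P x t ** N x t)) (A ** S_x x t + S_x x t ** C) x t \<and>
      has_dt (\<lambda>x t. \<i> *\<^sub>m (P x t ** N x t)) (A ** S_t x t + S_t x t ** C) x t"
    by (simp add: S_x_def S_t_def mat_expand A_simps algebra_simps)
next
  show "A ** S 0 0 + S 0 0 ** C = \<i> *\<^sub>m (P 0 0 ** N 0 0)"
    using node0 by (simp add: N_def matrix_mul_assoc)
qed

lemma ctranspose_N: "ctranspose (N (- x) t) = P x t ** J"
  by (simp add: N_def ctranspose_expand ctranspose_J)

text \<open>The right-hand sides of the system for \<open>S\<close> are such that \<open>- S(-x,t)\<^sup>*\<close> has the same gradient as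
  \<open>S(x,t)\<close>.\<close>

theorem S_antisymmetric:
  assumes xt: "x \<in> X" "t \<in> T"
  shows "ctranspose (S (- x) t) = - S x t"
proof -
  have "S x t = - ctranspose (S (- x) t)"
  proof (rule same_gradient_same_function[OF X(2,3) T(2,3) _ _ _ xt, where \<alpha> = S_x and \<beta> = S_t])
    fix x t assume xt: "x \<in> X" "t \<in> T"
    show "has_dx S (S_x x t) x t \<and> has_dt S (S_t x t) x t"
      using has_dx_S[OF xt] has_dt_S[OF xt] by blast
    note xt' = X_symmetric[OF xt(1)] xt(2)
    have "has_dx (\<lambda>x t. - ctranspose (S (- x) t)) (- ctranspose (- S_x (- x) t)) x t"
      by (intro has_vector_derivative_minus has_vector_derivative_ctranspose
          has_vector_derivative_reflect has_dx_S xt')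
    moreover have "- ctranspose (- S_x (- x) t) = S_x x t"
      by (simp add: S_x_def ctranspose_expand ctranspose_N mat_expand
          q1_symmetric[THEN mult_eq_extend] flip: N_def)
    moreover have "has_dt (\<lambda>x t. - ctranspose (S (- x) t)) (- ctranspose (S_t (- x) t)) x t"
      by (intro has_vector_derivative_minus has_vector_derivative_ctranspose has_dt_S xt')
    moreover have "- ctranspose (S_t (- x) t) = S_t x t"
    proof -
      have Ai: "ctranspose Ci = Ai"
        by (simp add: Ci_eq[symmetric] ctranspose_ctranspose)
      have "J ** ctranspose (Q (- x) t) ** ctranspose (P (- x) t) = Q x t ** N x t"
        by (simp add: Q_symmetric[OF xt] matrix_mul_assoc[symmetric] N_def)
      then show ?thesis
        by (simp add: S_t_def ctranspose_expand ctranspose_N mat_expand Ai Ci_eq)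
    qed
    ultimately show "has_dx (\<lambda>x t. - ctranspose (S (- x) t)) (S_x x t) x t \<and>
        has_dt (\<lambda>x t. - ctranspose (S (- x) t)) (S_t x t) x t"
      by simp
  qed (use S0 in simp)
  then show ?thesis by simp
qed

definition E where "E = {(x, t) \<in> X \<times> T. invertible (S x t)}"

lemma E_D: "(x, t) \<in> E \<Longrightarrow> x \<in> X" "(x, t) \<in> E \<Longrightarrow> t \<in> T" "(x, t) \<in> E \<Longrightarrow> invertible (S x t)"
  by (auto simp: E_def)

lemma E_symmetric:
  assumes "(x, t) \<in> E"
  shows "(- x, t) \<in> E" "ctranspose (matrix_inv (S (- x) t)) = - matrix_inv (S x t)"
proof -
  note xt = E_D[OF assms]
  have "S (- x) t = - ctranspose (S x t)"
    using S_antisymmetric[OF X_symmetric[OF xt(1)] xt(2)] by simp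
  then have inv: "invertible (S (- x) t)"
    using matrix_inv_uminus(1)[OF invertible_ctranspose(1)[OF xt(3)]] by simp
  then show "(- x, t) \<in> E" using xt X_symmetric by (auto simp: E_def)
  have "ctranspose (matrix_inv (S (- x) t)) = matrix_inv (ctranspose (S (- x) t))"
    by (simp add: invertible_ctranspose(2)[OF inv])
  also have "\<dots> = - matrix_inv (S x t)"
    by (simp add: S_antisymmetric[OF xt(1,2)] matrix_inv_uminus(2)[OF xt(3)])
  finally show "ctranspose (matrix_inv (S (- x) t)) = - matrix_inv (S x t)" .
qed

text \<open>Identities on \<open>E\<close> may be differentiated in \<open>x\<close>.\<close>

lemma E_open_x:
  assumes "(x, t) \<in> E"
  obtains U where "open U" "x \<in> U" "\<And>y. y \<in> U \<Longrightarrow> (y, t) \<in> E"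
proof -
  note xt = E_D[OF assms]
  have "((\<lambda>y. S y t) \<longlongrightarrow> S x t) (at x)"
    using has_vector_derivative_continuous[OF has_dx_S[OF xt(1,2)]] by (simp add: continuous_at)
  from eventually_invertible[OF this xt(3)]
  have "\<forall>\<^sub>F y in nhds x. invertible (S y t)"
    using xt(3) by (auto simp: eventually_at_filter elim!: eventually_mono)
  then obtain U where U: "open U" "x \<in> U" "\<And>y. y \<in> U \<Longrightarrow> invertible (S y t)"
    by (auto simp: eventually_nhds)
  show ?thesis
    by (rule that[of "U \<inter> X"]) (use U X(1) xt in \<open>auto simp: E_def\<close>)
qed

lemma node_at: "(x, t) \<in> E \<Longrightarrow> s_node A C (S x t) (P x t) (N x t)"
  using node_identity inv_A inv_C by (simp add: s_node_def E_def)

definition B where "B x t = N x t ** matrix_inv (S x t)"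

abbreviation "V' \<equiv> V_tilde V P S"
abbreviation "R' \<equiv> R_tilde p R V A P S"
abbreviation "Q' \<equiv> Q_m1_tilde p R V A P S"
abbreviation "q' \<equiv> q0 p V'"

lemma V_tilde_eq: "V' x t = V x t + (\<i> / 2) *\<^sub>m (J ** (B x t ** P x t) - jmat ** (J ** (B x t ** P x t)) ** jmat)"
  by (simp add: V_tilde_def B_def N_def j_simps matrix_mul_assoc[symmetric])

lemma X_eq: "X_m1 p A P S x t = \<i> *\<^sub>m (B x t ** Ai ** P x t)"
  by (simp add: X_m1_def B_def N_def matrix_mul_assoc)

lemma Y_eq: "Y_m1 p A P S x t = (- \<i>) *\<^sub>m (N x t ** Ci ** matrix_inv (S x t) ** P x t)"
  by (simp add: Y_m1_def N_def Ci_eq matrix_mul_assoc)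

lemma w_A_eq: "w_A p A P S lam x t = mat 1 - \<i> *\<^sub>m (B x t ** matrix_inv (A - mat lam) ** P x t)"
  by (simp add: w_A_def B_def N_def matrix_mul_assoc)

context
  fixes x t
  assumes xt: "(x, t) \<in> E"
begin

interpretation n: s_node A C "S x t" "P x t" "N x t"
  by (rule node_at[OF xt])

lemma node_B: "n.B = B x t" by (simp add: n.B_def B_def)
lemma node_X: "n.X = X_m1 p A P S x t" by (simp add: n.X_def X_eq node_B)
lemma node_Y: "n.Y = Y_m1 p A P S x t" by (simp add: n.Y_def Y_eq)
lemma node_Q_dressed: "n.Q_dressed (Q x t) = Q' x t" by (simp add: n.Q_dressed_def Q_m1_tilde_def node_X node_Y)

lemma node_q_dressed: "n.q_dressed (q x t) q1 = q' x t"
  by (simp add: n.q_dressed_def n.X0_def node_B q0_def q1_def V_tilde_eq mat_expand j_simps algebra_simps)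

lemma has_dx_B: "has_dx B (- (q' x t ** B x t + q1 ** B x t ** A)) x t"
proof -
  note D = E_D[OF xt]
  have "has_dx B (N x t ** (- (matrix_inv (S x t) ** S_x x t ** matrix_inv (S x t)))
      + (- (q x t ** N x t) + q1 ** N x t ** C) ** matrix_inv (S x t)) x t"
    unfolding B_def
    by (intro has_vector_derivative_matrix_mult has_vector_derivative_matrix_inv has_dx_N has_dx_S D)
  then show ?thesis
    using n.B_x[of "q x t" q1] by (simp add: node_q_dressed node_B S_x_def mat_expand)
qed

lemma has_dt_B: "has_dt B (- (Q' x t ** B x t ** Ai)) x t"
proof -
  note D = E_D[OF xt]
  have "has_dt B (N x t ** (- (matrix_inv (S x t) ** S_t x t ** matrix_inv (S x t)))
      + (Q x t ** N x t ** Ci) ** matrix_inv (S x t)) x t"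
    unfolding B_def
    by (intro has_vector_derivative_matrix_mult has_vector_derivative_matrix_inv has_dt_N has_dt_S D)
  then show ?thesis
    using n.B_t[of "Q x t"] by (simp add: node_Q_dressed node_B S_t_def mat_expand)
qed

lemma has_dx_w_A:
  assumes l: "invertible (A - mat l)"
  shows "has_dx (w_A p A P S l) (w_A p A P S l x t ** (q x t + l *\<^sub>m q1)
    - (q' x t + l *\<^sub>m q1) ** w_A p A P S l x t) x t"
proof -
  note D = E_D[OF xt]
  let ?R = "matrix_inv (A - mat l)"
  have "has_dx (w_A p A P S l) (0 - \<i> *\<^sub>m (B x t ** ?R ** (P x t ** q x t + A ** P x t ** q1)
      + (B x t ** 0 + - (q' x t ** B x t + q1 ** B x t ** A) ** ?R) ** P x t)) x t"
    unfolding w_A_eq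
    by (intro has_vector_derivative_diff has_vector_derivative_cscale has_vector_derivative_matrix_mult
        has_vector_derivative_const has_dx_B has_dx_P D)
  moreover have "0 - \<i> *\<^sub>m (B x t ** ?R ** (P x t ** q x t + A ** P x t ** q1)
      + (B x t ** 0 + - (q' x t ** B x t + q1 ** B x t ** A) ** ?R) ** P x t) =
      w_A p A P S l x t ** (q x t + l *\<^sub>m q1) - (q' x t + l *\<^sub>m q1) ** w_A p A P S l x t"
    using n.wave_x[OF l refl, of "q x t" q1]
    by (simp add: w_A_eq node_q_dressed node_B matrix_mult_zero_right)
  ultimately show ?thesis by simp
qed

lemma has_dt_w_A:
  assumes l: "invertible (A - mat l)" "l \<noteq> 0"
  shows "has_dt (w_A p A P S l) ((1 / l) *\<^sub>m (w_A p A P S l x t ** Q x t - Q' x t ** w_A p A P S l x t)) x t"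
proof -
  note D = E_D[OF xt]
  let ?R = "matrix_inv (A - mat l)"
  have "has_dt (w_A p A P S l) (0 - \<i> *\<^sub>m (B x t ** ?R ** (Ai ** P x t ** Q x t)
      + (B x t ** 0 + - (Q' x t ** B x t ** Ai) ** ?R) ** P x t)) x t"
    unfolding w_A_eq
    by (intro has_vector_derivative_diff has_vector_derivative_cscale has_vector_derivative_matrix_mult
        has_vector_derivative_const has_dt_B has_dt_P D)
  moreover have "0 - \<i> *\<^sub>m (B x t ** ?R ** (Ai ** P x t ** Q x t)
      + (B x t ** 0 + - (Q' x t ** B x t ** Ai) ** ?R) ** P x t) =
      (1 / l) *\<^sub>m (w_A p A P S l x t ** Q x t - Q' x t ** w_A p A P S l x t)"
    using n.wave_t[OF l(1) refl l(2), of "Q x t"]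
    by (simp add: w_A_eq node_Q_dressed node_B matrix_mult_zero_right)
  ultimately show ?thesis by simp
qed

text \<open>Forming \<open>M - j M j\<close> doubles the part of \<open>M\<close> that anticommutes with \<open>j\<close> and removes the rest.\<close>

lemma Q_split: "J ** Q x t - jmat ** (J ** Q x t) ** jmat = - 2 *\<^sub>R dt V x t"
proof -
  note D = E_D[OF xt]
  have "J ** Q x t = \<i> *\<^sub>m (J ** jmat ** R x t) - dt V x t"
    by (simp add: Q_m1_def mat_expand j_simps)
  moreover have "jmat ** (J ** jmat ** R x t) ** jmat = J ** jmat ** R x t"
    using R_commutes[OF D(1,2), symmetric] by (simp add: mat_expand j_simps)
  moreover have "jmat ** dt V x t ** jmat = - dt V x t"
    using dtV_anticommutes[OF D(1,2)] by (simp add: mat_expand j_simps)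
  ultimately show ?thesis
    by (simp add: mat_expand scaleR_2)
qed

text \<open>The transformed \<open>V\<close> is \<open>V\<close> plus \<open>(j\<^sup>p X\<^sub>0 - j j\<^sup>p X\<^sub>0 j) / 2\<close>, and \<open>(X\<^sub>0)\<^sub>t = Q - Q'\<close>. The contribution of \<open>Q\<close>
  cancels \<open>V\<^sub>t\<close>.\<close>

lemma has_dt_V_tilde: "has_dt V' (- (1 / 2) *\<^sub>R (J ** Q' x t - jmat ** (J ** Q' x t) ** jmat)) x t"
proof -
  note D = E_D[OF xt]
  let ?M = "B x t ** (Ai ** P x t ** Q x t) + - (Q' x t ** B x t ** Ai) ** P x t"
  have M: "\<i> *\<^sub>m ?M = Q x t - Q' x t"
    using n.X0_t[of "Q x t"] by (simp add: node_B node_Q_dressed)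
  have "has_dt V' (dt V x t + (\<i> / 2) *\<^sub>m ((J ** ?M + 0 ** (B x t ** P x t))
      - (jmat ** (J ** (B x t ** P x t)) ** 0
        + (jmat ** (J ** ?M + 0 ** (B x t ** P x t)) + 0 ** (J ** (B x t ** P x t))) ** jmat))) x t"
    unfolding V_tilde_eq
    by (intro has_vector_derivative_add has_vector_derivative_diff has_vector_derivative_cscale
        has_vector_derivative_matrix_mult has_vector_derivative_const has_dt_B has_dt_P has_dt_V D)
  moreover have "dt V x t + (\<i> / 2) *\<^sub>m ((J ** ?M + 0 ** (B x t ** P x t))
      - (jmat ** (J ** (B x t ** P x t)) ** 0
        + (jmat ** (J ** ?M + 0 ** (B x t ** P x t)) + 0 ** (J ** (B x t ** P x t))) ** jmat))
    = dt V x t + (1 / 2) *\<^sub>m (J ** (\<i> *\<^sub>m ?M) - jmat ** (J ** (\<i> *\<^sub>m ?M)) ** jmat)"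
    by (simp only: mat_expand add_0_right add_0_left diff_0_right) (simp add: mat_expand)
  moreover have "\<dots> = dt V x t + (1 / 2) *\<^sub>R (J ** Q x t - jmat ** (J ** Q x t) ** jmat)
      - (1 / 2) *\<^sub>R (J ** Q' x t - jmat ** (J ** Q' x t) ** jmat)"
    unfolding M by (simp add: scaleR_eq_cscale mat_expand algebra_simps)
  ultimately show ?thesis
    unfolding Q_split by simp
qed

lemma dt_V_tilde: "dt V' x t = - (1 / 2) *\<^sub>R (J ** Q' x t - jmat ** (J ** Q' x t) ** jmat)"
  unfolding dt_def by (rule vector_derivative_at[OF has_dt_V_tilde])

lemma V_tilde_anticommutes: "V' x t ** jmat = - (jmat ** V' x t)"
  using V_anticommutes[OF E_D(1,2)[OF xt]]
  by (simp add: V_tilde_eq mat_expand j_simps algebra_simps)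

lemma dt_V_tilde_anticommutes: "dt V' x t ** jmat = - (jmat ** dt V' x t)"
  by (simp add: dt_V_tilde scaleR_eq_cscale mat_expand j_simps algebra_simps)

lemma R_tilde_commutes: "jmat ** R' x t = R' x t ** jmat"
  by (simp add: R_tilde_def mat_expand j_simps add.commute)

text \<open>The term with the transformed \<open>R\<close> is the part of \<open>Q'\<close> that commutes with \<open>j\<close>, the term with the
  transformed \<open>V\<close> the part that anticommutes with \<open>j\<close>.\<close>

lemma Q_m1_of_transformed: "Q_m1 p R' V' x t = Q' x t"
  by (simp add: Q_m1_def dt_V_tilde R_tilde_def scaleR_eq_cscale mat_expand j_simps
      flip: cscale_add_left)

end

end

context darboux
begin

text \<open>With \<open>W = w\<^sub>A\<close> at \<open>\<lambda> = 0\<close> one has \<open>Q' = W Q W\<inverse>\<close>, and \<open>W\<close> is a gauge transformation from \<open>q\<^sub>0\<close> to \<open>q\<^sub>0'\<close>: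
  the equation for \<open>Q\<close> is conjugated into that for \<open>Q'\<close>.\<close>

lemma has_dx_Q_tilde:
  assumes xt: "(x, t) \<in> E"
  shows "has_dx Q' (Q' x t ** q' x t - q' x t ** Q' x t) x t"
proof -
  note D = E_D[OF xt]
  let ?W = "w_A p A P S 0"
  have W: "?W y s = mat 1 - X_m1 p A P S y s" for y s
    by (simp add: w_A_eq X_eq mat_0)
  have inv: "invertible (?W y s)" "matrix_inv (?W y s) = mat 1 + Y_m1 p A P S y s" if "(y, s) \<in> E" for y s
  proof -
    interpret n: s_node A C "S y s" "P y s" "N y s" by (rule node_at[OF that])
    show "invertible (?W y s)" "matrix_inv (?W y s) = mat 1 + Y_m1 p A P S y s"
      using n.invertible_transfer n.matrix_inv_transfer
      by (simp_all add: W node_X[OF that] node_Y[OF that])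
  qed
  have Q': "Q' y s = ?W y s ** Q y s ** matrix_inv (?W y s)" if "(y, s) \<in> E" for y s
    by (simp add: Q_m1_tilde_def W[symmetric] inv(2)[OF that])
  define W1 where "W1 = ?W x t ** q x t - q' x t ** ?W x t"
  have "has_dx ?W W1 x t"
    using has_dx_w_A[OF xt, of 0] inv_A by (simp add: W1_def cscale_zero_left mat_0)
  then have "has_dx (\<lambda>y s. ?W y s ** Q y s ** matrix_inv (?W y s))
    (?W x t ** Q x t ** - (matrix_inv (?W x t) ** W1 ** matrix_inv (?W x t))
      + (?W x t ** (Q x t ** q x t - q x t ** Q x t) + W1 ** Q x t) ** matrix_inv (?W x t)) x t"
    by (intro has_vector_derivative_matrix_mult has_vector_derivative_matrix_inv inv xt has_dx_Q D)
  moreover note WW = matrix_inv_left[OF inv(1)[OF xt]] matrix_inv_right[OF inv(1)[OF xt]]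
  have "?W x t ** Q x t ** - (matrix_inv (?W x t) ** W1 ** matrix_inv (?W x t))
      + (?W x t ** (Q x t ** q x t - q x t ** Q x t) + W1 ** Q x t) ** matrix_inv (?W x t)
    = Q' x t ** q' x t - q' x t ** Q' x t"
    by (simp add: Q'[OF xt] W1_def mat_expand WW WW[THEN mult_eq_extend])
  ultimately have deriv: "has_dx (\<lambda>y s. ?W y s ** Q y s ** matrix_inv (?W y s))
      (Q' x t ** q' x t - q' x t ** Q' x t) x t"
    by simp
  obtain U where U: "open U" "x \<in> U" "\<And>y. y \<in> U \<Longrightarrow> (y, t) \<in> E"
    using E_open_x[OF xt] by blast
  show ?thesis
    by (rule has_vector_derivative_transform_within_open[OF deriv U(1,2)]) (simp add: Q' U(3))
qed

theorem transformed_equations: "dispersionless_eqs E p R' V'"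
  unfolding dispersionless_eqs_def
proof (clarify, intro conjI)
  fix x t assume xt: "(x, t) \<in> E"
  let ?r = "((-1) ^ p / 2) *\<^sub>R (V' x t ** dt V' x t + dt V' x t ** V' x t)"
  let ?w = "(1 / 2) *\<^sub>R (V' x t ** R' x t + R' x t ** V' x t)"
  note R = R_tilde_commutes[OF xt] and V = V_tilde_anticommutes[OF xt]
    and W = dt_V_tilde_anticommutes[OF xt]
  show "(\<lambda>s. V' x s) differentiable (at t)"
    by (rule differentiableI_vector[OF has_dt_V_tilde[OF xt]])
  have Qx: "Q' x t ** q' x t - q' x t ** Q' x t = \<i> *\<^sub>m (jmat ** ?r) - J ** ?w"
    by (rule zero_curvature_algebra[OF p R V W, symmetric])
      (simp_all add: Q_m1_of_transformed[OF xt, symmetric] Q_m1_def[of p R' V'] q0_def)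
  define D where "D = \<i> *\<^sub>m (jmat ** ?r) - J ** ?w"
  have neg_half: "- (1 / 2) *\<^sub>R (- M - M) = M" for M :: "('m1, 'm2) blockmat"
    using scaleR_half_double[of M] by (simp add: scaleR_diff_right scaleR_add_right)
  have dQ: "has_dx Q' D x t"
    using has_dx_Q_tilde[OF xt] unfolding Qx D_def .
  note comm = R[symmetric] V W
  have r: "?r ** jmat = jmat ** ?r"
    by (simp add: scaleR_eq_cscale mat_expand comm comm[THEN mult_eq_extend])
  have w: "?w ** jmat = - (jmat ** ?w)"
    by (simp add: scaleR_eq_cscale mat_expand comm comm[THEN mult_eq_extend] add.commute)
  have "has_dx R' ((1 / (2 * \<i>)) *\<^sub>m ((Q' x t ** 0 + D ** jmat) + (jmat ** D + 0 ** Q' x t))) x t"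
    unfolding R_tilde_def
    by (intro has_vector_derivative_cscale has_vector_derivative_add has_vector_derivative_matrix_mult
        has_vector_derivative_const dQ)
  moreover have "(1 / (2 * \<i>)) *\<^sub>m ((Q' x t ** 0 + D ** jmat) + (jmat ** D + 0 ** Q' x t))
      = (1 / (2 * \<i>)) *\<^sub>m (\<i> *\<^sub>m ?r + \<i> *\<^sub>m ?r)"
    using r w by (simp add: D_def mat_expand j_simps)
  moreover have "\<dots> = ?r"
    by (simp only: cscale_double cscale_cscale) (simp add: cscale_one)
  ultimately show "has_dx R' ?r x t" by simp
  have "has_dx (\<lambda>y s. - (1 / 2) *\<^sub>R (J ** Q' y s - jmat ** (J ** Q' y s) ** jmat))
      (- (1 / 2) *\<^sub>R ((J ** D + 0 ** Q' x t)
        - (jmat ** (J ** Q' x t) ** 0 + (jmat ** (J ** D + 0 ** Q' x t) + 0 ** (J ** Q' x t)) ** jmat))) x t"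
    by (intro bounded_linear.has_vector_derivative[OF bounded_linear_scaleR_right]
        has_vector_derivative_diff has_vector_derivative_matrix_mult has_vector_derivative_const dQ)
  moreover have "- (1 / 2) *\<^sub>R ((J ** D + 0 ** Q' x t)
        - (jmat ** (J ** Q' x t) ** 0 + (jmat ** (J ** D + 0 ** Q' x t) + 0 ** (J ** Q' x t)) ** jmat))
      = - (1 / 2) *\<^sub>R (- ?w - ?w)"
    using r w by (simp add: D_def mat_expand j_simps)
  moreover have "\<dots> = ?w"
    by (rule neg_half)
  ultimately have deriv: "has_dx (\<lambda>y s. - (1 / 2) *\<^sub>R (J ** Q' y s - jmat ** (J ** Q' y s) ** jmat)) ?w x t"
    by simp
  obtain U where U: "open U" "x \<in> U" "\<And>y. y \<in> U \<Longrightarrow> (y, t) \<in> E"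
    using E_open_x[OF xt] by blast
  show "has_dx (dt V') ?w x t"
    by (rule has_vector_derivative_transform_within_open[OF deriv U(1,2)]) (simp add: dt_V_tilde U(3))
qed

lemma V_tilde_symmetric:
  assumes xt: "(x, t) \<in> E"
  shows "V' x t = ctranspose (V' (- x) t)"
  using V_symmetric[OF E_D(1,2)[OF xt]] E_symmetric(2)[OF xt]
  by (simp add: V_tilde_def ctranspose_expand ctranspose_jmat mat_expand)

text \<open>Reflection and conjugate transposition exchange \<open>X\<^sub>-\<^sub>1\<close> and \<open>- Y\<^sub>-\<^sub>1\<close>, up to conjugation by \<open>j\<^sup>p\<close>.\<close>

lemma Q_tilde_symmetric:
  assumes xt: "(x, t) \<in> E"
  shows "ctranspose (Q' (- x) t) = J ** Q' x t ** J"
proof -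
  note D = E_D[OF xt]
  have Q: "ctranspose (Q (- x) t) = J ** Q x t ** J"
    using arg_cong[OF Q_symmetric[OF D(1,2)], of "(**) J"] by (simp add: matrix_mul_assoc JJ)
  have X: "ctranspose (X_m1 p A P S (- x) t) = - (J ** Y_m1 p A P S x t ** J)"
    using E_symmetric(2)[OF xt]
    by (simp add: X_m1_def Y_m1_def ctranspose_expand ctranspose_J mat_expand j_simps)
  have Y: "ctranspose (Y_m1 p A P S (- x) t) = - (J ** X_m1 p A P S x t ** J)"
    using E_symmetric(2)[OF xt]
    by (simp add: X_m1_def Y_m1_def ctranspose_expand ctranspose_J mat_expand j_simps)
  show ?thesis
    by (simp add: Q_m1_tilde_def ctranspose_expand Q X Y mat_expand j_simps)
qed

lemma R_tilde_symmetric: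
  assumes xt: "(x, t) \<in> E"
  shows "R' x t = - ctranspose (R' (- x) t)"
proof -
  have "p = 0 \<or> p = 1" using p by auto
  then have "J ** R' x t ** J = R' x t"
    using R_tilde_commutes[OF xt, symmetric]
    by (elim disjE) (simp_all add: mat_expand jj[THEN mult_eq_extend])
  moreover have "ctranspose (R' (- x) t) = - (J ** R' x t ** J)"
    by (simp add: R_tilde_def ctranspose_expand ctranspose_jmat Q_tilde_symmetric[OF xt] mat_expand
        j_simps add.commute)
  ultimately show ?thesis by simp
qed

lemma V_tilde_upper_right:
  assumes xt: "x \<in> X" "t \<in> T"
  shows "(\<chi> r c. V' x t $ Inl r $ Inr c) = v_tilde v P S x t"
proof -
  define K where "K = ctranspose (P (- x) t) ** matrix_inv (S x t) ** P x t"
  have "V' x t = V x t + (\<i> / 2) *\<^sub>m (K - jmat ** K ** jmat)"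
    by (simp add: V_tilde_def K_def matrix_mul_assoc)
  then have "V' x t $ Inl r $ Inr c = v x t $ r $ c + \<i> * K $ Inl r $ Inr c" for r c
    by (simp add: form_at(3)[OF xt] block_def cscale_def jmat_mult_nth mult_jmat_nth)
  moreover have "K $ Inl r $ Inr c =
      (ctranspose (left_block (P (- x) t)) ** matrix_inv (S x t) ** right_block (P x t)) $ r $ c" for r c
    by (simp add: K_def matrix_matrix_mult_def ctranspose_def left_block_def right_block_def)
  ultimately show ?thesis
    by (simp add: v_tilde_def vec_eq_iff cscale_def)
qed

theorem transformed_nonlocal_form: "\<exists>\<rho>1' \<rho>2'. nonlocal_form E R' V' \<rho>1' \<rho>2' (v_tilde v P S)"
proof (intro exI)
  have "V' x t = block 0 (v_tilde v P S x t) (ctranspose (v_tilde v P S (- x) t)) 0"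
    if xt: "(x, t) \<in> E" for x t
  proof -
    note D = E_D[OF xt] and D' = E_D[OF E_symmetric(1)[OF xt]]
    have "(\<chi> r c. V' x t $ Inr r $ Inl c) = ctranspose (\<chi> r c. V' (- x) t $ Inl r $ Inr c)"
      by (subst V_tilde_symmetric[OF xt]) (simp add: ctranspose_def vec_eq_iff)
    then show ?thesis
      using anticommutes_imp_block_off_diagonal[OF V_tilde_anticommutes[OF xt]]
      by (simp add: V_tilde_upper_right[OF D(1,2)] V_tilde_upper_right[OF D'(1,2)])
  qed
  then show "nonlocal_form E R' V' (\<lambda>x t. \<chi> r c. R' x t $ Inl r $ Inl c)
      (\<lambda>x t. \<chi> r c. R' x t $ Inr r $ Inr c) (v_tilde v P S)"
    using commutes_imp_block_diagonal[OF R_tilde_commutes] R_tilde_symmetric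
    unfolding nonlocal_form_def by blast
qed

text \<open>The determinant of \<open>w\<^sub>A\<close> at the origin is nonzero because \<open>w\<^sub>A\<close> is \<open>I - X\<close> for the node shifted by
  \<open>\<lambda>\<close>; this is where \<open>\<lambda>\<close> has to avoid the spectrum of \<open>- A\<^sup>*\<close> besides that of \<open>A\<close>.\<close>

theorem transformed_wave_function:
  assumes lam: "lam \<noteq> 0" "lam \<notin> spectrum A" "lam \<notin> spectrum (- C)"
    and w: "wave_function (X \<times> T) p R V lam w"
  shows "wave_function E p R' V' lam (\<lambda>x t. w_A p A P S lam x t ** w x t)"
proof -
  have inv1: "invertible (A - mat lam)" using lam by (simp add: spectrum_def)
  have "invertible (- C - mat lam)" using lam by (simp add: spectrum_def)
  then have "invertible (- (- C - mat lam))" by (rule matrix_inv_uminus)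
  then have inv2: "invertible (C + mat lam)" by (simp add: add.commute)
  have mat: "mat lam = lam *\<^sub>m (mat 1 :: complex ^ 'n ^ 'n)"
    by (simp add: cscale_def mat_def vec_eq_iff)
  have "(A - mat lam) ** S 0 0 + S 0 0 ** (C + mat lam) = \<i> *\<^sub>m (P 0 0 ** N 0 0)"
    using node_identity[OF X(3) T(3)] by (simp add: mat mat_expand)
  then interpret n: s_node "A - mat lam" "C + mat lam" "S 0 0" "P 0 0" "N 0 0"
    using inv1 inv2 inv_S0 by (simp add: s_node_def)
  have "w_A p A P S lam 0 0 = mat 1 - n.X"
    by (simp add: w_A_eq n.X_def n.B_def B_def)
  then have "det (w_A p A P S lam 0 0) \<noteq> 0"
    using n.invertible_transfer by (simp add: invertible_det_nz)
  moreover have "det (w 0 0) \<noteq> 0" using w by (simp add: wave_function_def)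
  moreover have "has_dx (\<lambda>x t. w_A p A P S lam x t ** w x t)
      (G_aux p V' lam x t ** (w_A p A P S lam x t ** w x t)) x t"
    "has_dt (\<lambda>x t. w_A p A P S lam x t ** w x t)
      (F_aux p R' V' lam x t ** (w_A p A P S lam x t ** w x t)) x t"
    if xt: "(x, t) \<in> E" for x t
  proof -
    note D = E_D[OF xt]
    have wx: "has_dx w (G_aux p V lam x t ** w x t) x t" and wt: "has_dt w (F_aux p R V lam x t ** w x t) x t"
      using w D by (auto simp: wave_function_def)
    have G': "G_aux p V' lam x t = - (q' x t + lam *\<^sub>m q1)"
      by (simp add: G_aux_def q0_def q1_def mat_expand mult.commute)
    show "has_dx (\<lambda>x t. w_A p A P S lam x t ** w x t)
      (G_aux p V' lam x t ** (w_A p A P S lam x t ** w x t)) x t"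
      using has_vector_derivative_matrix_mult[OF has_dx_w_A[OF xt inv1] wx]
      by (simp add: G_aux_eq G' mat_expand algebra_simps)
    show "has_dt (\<lambda>x t. w_A p A P S lam x t ** w x t)
      (F_aux p R' V' lam x t ** (w_A p A P S lam x t ** w x t)) x t"
      using has_vector_derivative_matrix_mult[OF has_dt_w_A[OF xt inv1 lam(1)] wt]
      by (simp add: F_aux_eq Q_m1_of_transformed[OF xt] mat_expand algebra_simps)
  qed
  ultimately show ?thesis
    by (auto simp: wave_function_def det_mul)
qed

end

section \<open>The transformation on a rectangle\<close>

lemma rect_dom_eq_Times:
  "rect_dom a b1 b2 = {x. - a < ereal x \<and> ereal x < a} \<times> {t. b1 < ereal t \<and> ereal t < b2}"
  by (auto simp: rect_dom_def)

lemma ereal_interval: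
  shows "open {x. b1 < ereal x \<and> ereal x < b2}" "convex {x. b1 < ereal x \<and> ereal x < b2}"
proof -
  have "{x. b1 < ereal x \<and> ereal x < b2} = ereal -` {b1<..<b2}" by auto
  then show "open {x. b1 < ereal x \<and> ereal x < b2}"
    by (simp add: open_ereal_vimage)
  have "is_interval {x. b1 < ereal x \<and> ereal x < b2}"
    unfolding is_interval_1 by (blast intro: less_le_trans le_less_trans ereal_less_eq(3)[THEN iffD2])
  then show "convex {x. b1 < ereal x \<and> ereal x < b2}" by (rule is_interval_convex)
qed

theorem theorem3p1:
  fixes p :: nat
    and a b1 b2 :: ereal
    and R V :: "real \<Rightarrow> real \<Rightarrow> complex ^ ('m1::finite + 'm2::finite) ^ ('m1 + 'm2)"
    and \<rho>1 :: "real \<Rightarrow> real \<Rightarrow> complex ^ 'm1 ^ 'm1"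
    and \<rho>2 :: "real \<Rightarrow> real \<Rightarrow> complex ^ 'm2 ^ 'm2"
    and v :: "real \<Rightarrow> real \<Rightarrow> complex ^ 'm2 ^ 'm1"
    and A S0 :: "complex ^ 'n ^ 'n"
    and P0 :: "complex ^ ('m1 + 'm2) ^ 'n"
  assumes "p \<in> {0, 1}"
    and "0 < a" and "b1 < 0" and "0 < b2"
    and "nonlocal_form (rect_dom a b1 b2) R V \<rho>1 \<rho>2 v"
    and "continuous_on (rect_dom a b1 b2) (\<lambda>(x, t). R x t)"
    and "continuous_on (rect_dom a b1 b2) (\<lambda>(x, t). V x t)"
    and "continuous_on (rect_dom a b1 b2) (\<lambda>(x, t). dt V x t)"
    and "dispersionless_eqs (rect_dom a b1 b2) p R V"
    and "invertible A" and "invertible S0" and "S0 = - ctranspose S0"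
    and "A ** S0 + S0 ** ctranspose A = \<i> *\<^sub>m (P0 ** mpow jmat p ** ctranspose P0)"
  shows
    "well_defined_on (rect_dom a b1 b2) (\<lambda>P. Pi_system (rect_dom a b1 b2) p R V A P \<and> P 0 0 = P0)
   \<and> (\<forall>P. Pi_system (rect_dom a b1 b2) p R V A P \<and> P 0 0 = P0 \<longrightarrow>
        well_defined_on (rect_dom a b1 b2) (\<lambda>S. S_system (rect_dom a b1 b2) p R V A P S \<and> S 0 0 = S0))
   \<and> (\<forall>lam w0. lam \<noteq> 0 \<and> det w0 \<noteq> 0 \<longrightarrow>
        well_defined_on (rect_dom a b1 b2) (\<lambda>w. wave_function (rect_dom a b1 b2) p R V lam w \<and> w 0 0 = w0))
   \<and> (\<forall>P S E. Pi_system (rect_dom a b1 b2) p R V A P \<and> P 0 0 = P0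
          \<and> S_system (rect_dom a b1 b2) p R V A P S \<and> S 0 0 = S0
          \<and> E = {(x, t) \<in> rect_dom a b1 b2. invertible (S x t)} \<longrightarrow>
        (\<exists>\<rho>1' \<rho>2'. nonlocal_form E (R_tilde p R V A P S) (V_tilde V P S)
                      \<rho>1' \<rho>2' (v_tilde v P S))
      \<and> (\<forall>(x, t) \<in> E. V_tilde V P S x t = ctranspose (V_tilde V P S (- x) t))
      \<and> dispersionless_eqs E p (R_tilde p R V A P S) (V_tilde V P S)
      \<and> (\<forall>lam w. lam \<notin> {0} \<union> spectrum A \<union> spectrum (- ctranspose A)
            \<and> wave_function (rect_dom a b1 b2) p R V lam w \<longrightarrow>
          wave_function E p (R_tilde p R V A P S) (V_tilde V P S) lam
            (\<lambda>x t. w_A p A P S lam x t ** w x t)))"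
proof -
  define X where "X = {x. - a < ereal x \<and> ereal x < a}"
  define T where "T = {t. b1 < ereal t \<and> ereal t < b2}"
  have D: "rect_dom a b1 b2 = X \<times> T" by (simp add: X_def T_def rect_dom_eq_Times)
  have X: "open X" "convex X" "0 \<in> X" and T: "open T" "convex T" "0 \<in> T"
    using assms(2-4) ereal_interval by (auto simp: X_def T_def ereal_uminus_less_reorder simp flip: zero_ereal_def)
  have X_sym: "- x \<in> X" if "x \<in> X" for x
    using that unfolding X_def by (auto simp: ereal_uminus_less_reorder ereal_less_uminus_reorder simp flip: uminus_ereal.simps)
  interpret darboux_seed X T p R V \<rho>1 \<rho>2 v A
    by unfold_locales (use assms X T X_sym D in auto)
  show ?thesis
    unfolding D
  proof (intro conjI allI impI)
    show "well_defined_on (X \<times> T) (\<lambda>P. Pi_system (X \<times> T) p R V A P \<and> P 0 0 = P0)"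
      by (rule Pi_solution(1))
    show "well_defined_on (X \<times> T) (\<lambda>S. S_system (X \<times> T) p R V A P S \<and> S 0 0 = S0)"
      if "Pi_system (X \<times> T) p R V A P \<and> P 0 0 = P0" for P
    proof -
      interpret darboux_pi X T p R V \<rho>1 \<rho>2 v A P by unfold_locales (use that in simp)
      show ?thesis by (rule S_well_defined)
    qed
    show "well_defined_on (X \<times> T) (\<lambda>w. wave_function (X \<times> T) p R V lam w \<and> w 0 0 = w0)"
      if "lam \<noteq> 0 \<and> det w0 \<noteq> 0" for lam w0
      using wave_function_well_defined that by blast
    fix P S E
    assume *: "Pi_system (X \<times> T) p R V A P \<and> P 0 0 = P0 \<and> S_system (X \<times> T) p R V A P S \<and> S 0 0 = S0
      \<and> E = {(x, t) \<in> X \<times> T. invertible (S x t)}"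
    interpret d: darboux X T p R V \<rho>1 \<rho>2 v A P S
      by unfold_locales (use * assms(11-13) in auto)
    have E: "E = d.E" using * by (simp add: d.E_def)
    show "\<exists>\<rho>1' \<rho>2'. nonlocal_form E (R_tilde p R V A P S) (V_tilde V P S) \<rho>1' \<rho>2' (v_tilde v P S)"
      unfolding E by (rule d.transformed_nonlocal_form)
    show "\<forall>(x, t) \<in> E. V_tilde V P S x t = ctranspose (V_tilde V P S (- x) t)"
      unfolding E using d.V_tilde_symmetric by blast
    show "dispersionless_eqs E p (R_tilde p R V A P S) (V_tilde V P S)"
      unfolding E by (rule d.transformed_equations)
    show "wave_function E p (R_tilde p R V A P S) (V_tilde V P S) lam (\<lambda>x t. w_A p A P S lam x t ** w x t)"
      if "lam \<notin> {0} \<union> spectrum A \<union> spectrum (- ctranspose A) \<and> wave_function (X \<times> T) p R V lam w" for lam w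
      unfolding E by (rule d.transformed_wave_function) (use that in auto)
  qed
qed

end
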